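(* Let $f\colon \mathbb{R}P^2\to\mathbb{R}$ be a real-analytic map and let $\epsilon>0$. Then for some $y\in\mathbb{R}$ the length of the fiber $f^{-1}(y)$ is at least $2\pi - \epsilon$.
   Context: $\mathbb{R}P^2=\mathbb{S}^2/\{\pm1\}$ carries the Riemannian metric (and real-analytic structure) induced from the unit round sphere $\mathbb{S}^2\subset\mathbb{R}^3$. Length means $1$-dimensional Hausdorff measure (possibly infinite). *)

theory Defs
  imports "HOL-Analysis.Analysis"
begin

section \<open>One-dimensional Hausdorff measure\<close>

text \<open>The covering pieces are required to be bounded because \<^const>\<open>diameter\<close> is a junk value on
  unbounded sets. In dimension one the usual normalising constant is 1, so the measure of a
  rectifiable arc is its length.\<close>

definition hausdorff1_pre :: "real \<Rightarrow> 'a::metric_space set \<Rightarrow> ennreal" where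
  "hausdorff1_pre \<delta> A =
     (INF U\<in>{U :: nat \<Rightarrow> 'a set. A \<subseteq> (\<Union>i. U i) \<and> (\<forall>i. bounded (U i) \<and> diameter (U i) \<le> \<delta>)}.
        \<Sum>i. ennreal (diameter (U i)))"

definition hausdorff1 :: "'a::metric_space set \<Rightarrow> ennreal" where
  "hausdorff1 A = (SUP \<delta>\<in>{0<..}. hausdorff1_pre \<delta> A)"


section \<open>Real-analytic functions of several variables\<close>

text \<open>Multi-indices are the functions \<open>m\<close> from \<^const>\<open>Basis\<close> to the naturals (extensional, so
  that each occurs once). \<open>has_sum\<close> is unconditional, hence absolute, convergence of the
  multivariate power series centred at \<open>p\<close>.\<close>

definition real_analytic_at :: "('a::euclidean_space \<Rightarrow> real) \<Rightarrow> 'a \<Rightarrow> bool" where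
  "real_analytic_at g p \<longleftrightarrow>
     (\<exists>(c :: ('a \<Rightarrow> nat) \<Rightarrow> real) r. 0 < r \<and>
        (\<forall>x\<in>ball p r.
           ((\<lambda>m. c m * (\<Prod>b\<in>Basis. ((x - p) \<bullet> b) ^ m b)) has_sum g x)
             (Basis \<rightarrow>\<^sub>E UNIV)))"

definition real_analytic_on :: "('a::euclidean_space \<Rightarrow> real) \<Rightarrow> 'a set \<Rightarrow> bool" where
  "real_analytic_on g S \<longleftrightarrow> (\<forall>p\<in>S. real_analytic_at g p)"


section \<open>The real projective plane\<close>

definition antipodal_rel :: "real^3 \<Rightarrow> real^3 \<Rightarrow> bool" where
  "antipodal_rel x y \<longleftrightarrow> x \<in> sphere 0 1 \<and> y \<in> sphere 0 1 \<and> (y = x \<or> y = - x)"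

quotient_type rp2 = "real^3" / partial: antipodal_rel
  morphisms rep_rp2 proj_rp2
proof (rule part_equivpI)
  have "antipodal_rel (axis 1 1) (axis 1 1)"
    by (simp add: antipodal_rel_def)
  then show "\<exists>x. antipodal_rel x x" ..
  show "symp antipodal_rel"
    by (auto simp: symp_def antipodal_rel_def)
  show "transp antipodal_rel"
    by (auto simp: transp_def antipodal_rel_def)
qed

text \<open>The Riemannian distance of the round sphere is the angle between unit vectors.\<close>

definition sphere_dist :: "real^3 \<Rightarrow> real^3 \<Rightarrow> real" where
  "sphere_dist x y = arccos (x \<bullet> y)"

lemma abs_inner_unit_le:
  fixes x y :: "'a::real_inner"
  assumes "norm x = 1" "norm y = 1"
  shows "\<bar>x \<bullet> y\<bar> \<le> 1"
  using Cauchy_Schwarz_ineq2[of x y] assms by simp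

lemma sphere_dist_triangle:
  assumes "norm x = 1" "norm y = 1" "norm z = 1"
  shows "sphere_dist x z \<le> sphere_dist x y + sphere_dist y z"
proof -
  define a b where "a = x \<bullet> y" and "b = y \<bullet> z"
  have ab: "\<bar>a\<bar> \<le> 1" "\<bar>b\<bar> \<le> 1" and xz: "\<bar>x \<bullet> z\<bar> \<le> 1"
    using assms by (auto simp: a_def b_def intro!: abs_inner_unit_le)
  have xx: "x \<bullet> x = 1" "y \<bullet> y = 1" "z \<bullet> z = 1"
    using assms by (simp_all add: dot_square_norm)
  have na: "norm (x - a *\<^sub>R y) = sqrt (1 - a\<^sup>2)" 
    unfolding norm_eq_sqrt_inner
    by (simp add: inner_diff_left inner_diff_right xx a_def inner_commute power2_eq_square)
  have nb: "norm (z - b *\<^sub>R y) = sqrt (1 - b\<^sup>2)"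
    unfolding norm_eq_sqrt_inner
    by (simp add: inner_diff_left inner_diff_right xx b_def inner_commute power2_eq_square)
  have "(x - a *\<^sub>R y) \<bullet> (z - b *\<^sub>R y) = x \<bullet> z - a * b"
    by (simp add: inner_diff_left inner_diff_right xx a_def b_def inner_commute)
  then have le: "a * b - sqrt (1 - a\<^sup>2) * sqrt (1 - b\<^sup>2) \<le> x \<bullet> z"
    using Cauchy_Schwarz_ineq2[of "x - a *\<^sub>R y" "z - b *\<^sub>R y"] na nb by simp
  show ?thesis
  proof (cases "arccos a + arccos b \<le> pi")
    case True
    have "cos (arccos a + arccos b) \<le> x \<bullet> z"
      using le ab by (simp add: cos_add sin_arccos_abs)
    then have "arccos (x \<bullet> z) \<le> arccos (cos (arccos a + arccos b))"
      using xz by (intro arccos_le_arccos) auto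
    also have "\<dots> = arccos a + arccos b"
      using True ab by (intro arccos_cos add_nonneg_nonneg arccos_lbound) auto
    finally show ?thesis
      by (simp add: sphere_dist_def a_def b_def)
  next
    case False
    moreover have "arccos (x \<bullet> z) \<le> pi"
      using xz by (intro arccos_ubound) auto
    ultimately show ?thesis
      by (simp add: sphere_dist_def a_def b_def)
  qed
qed

instantiation rp2 :: metric_space
begin

lift_definition dist_rp2 :: "rp2 \<Rightarrow> rp2 \<Rightarrow> real"
  is "\<lambda>x y. min (sphere_dist x y) (sphere_dist x (- y))"
  by (auto simp: antipodal_rel_def sphere_dist_def min.commute)

definition uniformity_rp2 :: "(rp2 \<times> rp2) filter" where
  "uniformity_rp2 = (INF e\<in>{0<..}. principal {(x, y). dist x y < e})"

definition open_rp2 :: "rp2 set \<Rightarrow> bool" where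
  "open_rp2 U \<longleftrightarrow> (\<forall>x\<in>U. eventually (\<lambda>(x', y). x' = x \<longrightarrow> y \<in> U) uniformity)"

instance
proof
  fix p q s :: rp2
  show "dist p q = 0 \<longleftrightarrow> p = q"
  proof (transfer, goal_cases)
    case (1 x y)
    then have n: "norm x = 1" "norm y = 1"
      by (auto simp: antipodal_rel_def)
    have eq: "arccos (x \<bullet> w) = 0 \<longleftrightarrow> w = x" and nn: "0 \<le> arccos (x \<bullet> w)"
      if "norm w = 1" for w
    proof -
      have *: "\<bar>x \<bullet> w\<bar> \<le> 1"
        using n that by (intro abs_inner_unit_le)
      then show "0 \<le> arccos (x \<bullet> w)"
        by (intro arccos_lbound) auto
      have "arccos (x \<bullet> w) = 0 \<longleftrightarrow> x \<bullet> w = 1"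
        using * by (metis arccos_1 cos_arccos_abs cos_zero)
      also have "\<dots> \<longleftrightarrow> w = x"
        using norm_cauchy_schwarz_eq[of x w] n that by auto
      finally show "arccos (x \<bullet> w) = 0 \<longleftrightarrow> w = x" .
    qed
    have "min (sphere_dist x y) (sphere_dist x (- y)) = 0 \<longleftrightarrow>
        sphere_dist x y = 0 \<or> sphere_dist x (- y) = 0"
      using nn[of y] nn[of "- y"] n by (auto simp: sphere_dist_def min_def)
    also have "\<dots> \<longleftrightarrow> y = x \<or> - y = x"
      using eq[of y] eq[of "- y"] n by (simp add: sphere_dist_def)
    also have "\<dots> \<longleftrightarrow> antipodal_rel x y"
      using n by (auto simp: antipodal_rel_def)
    finally show ?case .
  qed
  show "dist p q \<le> dist p s + dist q s"
  proof (transfer, goal_cases)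
    case (1 x y z)
    then have n: "norm x = 1" "norm y = 1" "norm z = 1"
      by (auto simp: antipodal_rel_def)
    have "sphere_dist x y \<le> sphere_dist x z + sphere_dist y z"
      "sphere_dist x (- y) \<le> sphere_dist x z + sphere_dist y (- z)"
      "sphere_dist x (- y) \<le> sphere_dist x (- z) + sphere_dist y z"
      "sphere_dist x y \<le> sphere_dist x (- z) + sphere_dist y (- z)"
      using sphere_dist_triangle[of x z y] sphere_dist_triangle[of x z "- y"]
        sphere_dist_triangle[of x "- z" "- y"] sphere_dist_triangle[of x "- z" y] n
      by (simp_all add: sphere_dist_def inner_commute)
    then show ?case
      by (simp add: min_def)
  qed
qed (rule uniformity_rp2_def open_rp2_def)+

end

text \<open>Inverses of the graph charts of the sphere: \<open>u\<close> in the open unit disc is sent to the point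
  of the open hemisphere \<open>0 < s * x $ k\<close> whose two remaining coordinates are \<open>u\<close>. Index
  arithmetic in type \<open>3\<close> is modulo 3. The projection is injective on each such hemisphere, so
  composing with \<^const>\<open>proj_rp2\<close> gives an atlas for the induced analytic structure.\<close>

definition hemisphere_param :: "real \<Rightarrow> 3 \<Rightarrow> real^2 \<Rightarrow> real^3" where
  "hemisphere_param s k u =
     (\<chi> i. if i = k then s * sqrt (1 - (norm u)\<^sup>2) else if i = k + 1 then u $ 1 else u $ 2)"

lemma sum_UNIV_3_cyclic: "(\<Sum>i\<in>UNIV. h i) = h k + h (k + 1) + h (k + (2::3))"
  for h :: "3 \<Rightarrow> real"
proof -
  have "h 4 = h 1" "h 5 = h 2"
    by (rule arg_cong[of _ _ h], simp)+
  then show ?thesis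
    using exhaust_3[of k] by (auto simp: sum_3 algebra_simps)
qed

lemma hemisphere_param_image:
  assumes s: "s = 1 \<or> s = -1"
  shows "hemisphere_param s k ` ball 0 1 = {x \<in> sphere 0 1. 0 < s * x $ k}"
proof -
  have k: "k + 1 \<noteq> k" "k + 2 \<noteq> k" "k + 2 \<noteq> k + 1"
    using exhaust_3[of k] by auto
  have ss: "s * s = 1"
    using s by auto
  have n2: "(norm u)\<^sup>2 = (u $ 1)\<^sup>2 + (u $ 2)\<^sup>2" for u :: "real^2"
    by (simp add: norm_vec_def L2_set_def sum_2)
  have n3: "(norm x)\<^sup>2 = (x $ k)\<^sup>2 + (x $ (k + 1))\<^sup>2 + (x $ (k + 2))\<^sup>2" for x :: "real^3"
    unfolding norm_vec_def L2_set_def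
    by (subst real_sqrt_pow2) (auto intro: sum_nonneg simp: sum_UNIV_3_cyclic[of _ k])
  show ?thesis
  proof (intro equalityI subsetI)
    fix x assume "x \<in> hemisphere_param s k ` ball 0 1"
    then obtain u where u: "norm u < 1" "x = hemisphere_param s k u"
      by auto
    have lt: "(norm u)\<^sup>2 < 1"
      using u by (simp add: power_less_one_iff abs_square_less_1)
    have c: "x $ k = s * sqrt (1 - (norm u)\<^sup>2)" "x $ (k + 1) = u $ 1" "x $ (k + 2) = u $ 2"
      using k by (simp_all add: u hemisphere_param_def)
    have "(norm x)\<^sup>2 = 1"
      unfolding n3 c power_mult_distrib using lt ss n2[of u] by (simp flip: power2_eq_square)
    moreover have "s * x $ k = sqrt (1 - (norm u)\<^sup>2)"
      unfolding c using ss by (simp add: mult.assoc[symmetric])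
    ultimately show "x \<in> {x \<in> sphere 0 1. 0 < s * x $ k}"
      using lt by (simp add: power2_eq_1_iff) (smt (verit) norm_ge_zero)
  next
    fix x assume "x \<in> {x \<in> sphere 0 1. 0 < s * x $ k}"
    then have x: "norm x = 1" "0 < s * x $ k"
      by auto
    define u :: "real^2" where "u = vector [x $ (k + 1), x $ (k + 2)]"
    have un: "1 - (norm u)\<^sup>2 = (x $ k)\<^sup>2"
      using n3[of x] x n2[of u] by (simp add: u_def)
    have "0 < (x $ k)\<^sup>2"
      using x by auto
    then have "(norm u)\<^sup>2 < 1"
      using un by linarith
    then have "norm u < 1"
      using abs_square_less_1[of "norm u"] by simp
    have "s * sqrt (1 - (norm u)\<^sup>2) = x $ k"
      unfolding un using s x by (auto simp: abs_if)
    moreover have "u $ 1 = x $ (k + 1)" "u $ 2 = x $ (k + 2)"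
      by (simp_all add: u_def)
    moreover have "i = k \<or> i = k + 1 \<or> i = k + 2" for i
      using exhaust_3[of k] exhaust_3[of i] by auto
    ultimately have "hemisphere_param s k u = x"
      by (simp add: vec_eq_iff hemisphere_param_def) metis
    with \<open>norm u < 1\<close> show "x \<in> hemisphere_param s k ` ball 0 1"
      by force
  qed
qed

definition real_analytic_rp2 :: "(rp2 \<Rightarrow> real) \<Rightarrow> bool" where
  "real_analytic_rp2 f \<longleftrightarrow>
     (\<forall>k. \<forall>s\<in>{1, -1}. real_analytic_on (\<lambda>u. f (proj_rp2 (hemisphere_param s k u))) (ball 0 1))"

end

theory Submission
  imports Defs
begin

text \<open>
  The proof counts intersections of fibres with projective lines. A line is the set of points
  orthogonal to a vector \<open>n\<close> of \<open>real^3\<close>, and Lebesgue measure on the unit ball of such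
  normals serves as a rotation invariant measure on the space of lines. By Crofton's formula a
  curve of length \<open>l\<close> in the projective plane meets a random line in \<open>l / pi\<close> points on average, so a
  fibre has length at least \<open>2 * pi - \<epsilon>\<close> as soon as almost all lines, up to a small proportion, meet
  it twice.

  A function on a line takes every value strictly between its minimum and its maximum at least
  twice, since the line is a closed loop. Any two lines meet, so the ranges of \<open>f\<close> on the various
  lines are intervals of which any two intersect, and all of them contain a common value \<open>a\<close>
  (\<open>minmax_over_great_circles\<close>). If only a null set of lines has maximum \<open>a\<close>, then a level \<open>y\<close>
  slightly above \<open>a\<close> lies strictly inside the range for almost all lines up to a small proportion, and
  \<open>f -` {y}\<close> is long (\<open>long_fiber_near_minmax\<close>). If only a null set of lines has minimum \<open>a\<close>, the same
  holds slightly below \<open>a\<close>. If neither set is null, then \<open>f = a\<close> wherever a line of the first kind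
  meets a line of the second kind; this gives infinitely many points on each line of the first kind,
  and \<open>f -` {a}\<close> has infinite length (\<open>infinite_fiber_length\<close>). Levels close to \<open>a\<close> have to be
  allowed, and \<open>\<epsilon>\<close> with them: if \<open>f\<close> is the square of a coordinate, the fibres are circles of
  length tending to \<open>2 * pi\<close> that collapse two-to-one onto a line of length \<open>pi\<close>.

  Only the inequality of Crofton's formula that bounds the length from below is used, directly
  for covers (\<open>crofton_lower_bound\<close>). To have the sharp constant, small pieces of the fibre must
  be almost straight. Analyticity provides strict differentiability
  (\<open>real_analytic_at_imp_strict_gradient\<close>), hence straightness away from critical points, and a
  one-dimensional theorem of Sard along each line, combined with Fubini, shows that for almost every level
  almost every line avoids the critical points on it (\<open>AE_level_AE_line_flat\<close>).
\<close>

section \<open>Strict differentiability of analytic functions\<close>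

text \<open>Strict differentiability at \<open>p\<close> relative to \<open>S\<close>: the linearisation is good for all secants near
  \<open>p\<close>, not only for those through \<open>p\<close>. This makes all secants of a level set near \<open>p\<close> almost
  orthogonal to the gradient, whereas differentiability at \<open>p\<close> controls only those that start at \<open>p\<close>.\<close>

definition has_strict_gradient :: "('a::real_inner \<Rightarrow> real) \<Rightarrow> 'a \<Rightarrow> 'a \<Rightarrow> 'a set \<Rightarrow> bool" where
  "has_strict_gradient F g x S \<longleftrightarrow>
     (\<forall>e>0. \<exists>r>0. \<forall>u\<in>S \<inter> ball x r. \<forall>v\<in>S \<inter> ball x r.
        \<bar>F u - F v - g \<bullet> (u - v)\<bar> \<le> e * norm (u - v))"

text \<open>Rescaling by \<open>t\<close> moves both points into the unit cube, where a product of \<open>k\<close> factors of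
  modulus at most 1 changes by at most the sum of the changes of its factors.\<close>

lemma monomial_diff_bound:
  fixes u v :: "'a::euclidean_space"
  assumes t: "0 < t" and u: "\<And>b. b \<in> Basis \<Longrightarrow> \<bar>u \<bullet> b\<bar> \<le> t" and v: "\<And>b. b \<in> Basis \<Longrightarrow> \<bar>v \<bullet> b\<bar> \<le> t"
  shows "t * \<bar>(\<Prod>b\<in>Basis. (u \<bullet> b) ^ m b) - (\<Prod>b\<in>Basis. (v \<bullet> b) ^ m b)\<bar>
    \<le> t ^ (\<Sum>b\<in>Basis. m b) * real (\<Sum>b\<in>Basis. m b) * norm (u - v)"
proof -
  define k where "k = (\<Sum>b\<in>Basis. m b)"
  have scale: "(\<Prod>b\<in>Basis. (w \<bullet> b) ^ m b) = t ^ k * (\<Prod>b\<in>Basis. (w \<bullet> b / t) ^ m b)" for w :: 'a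
  proof -
    have "(\<Prod>b\<in>Basis. (w \<bullet> b) ^ m b) = (\<Prod>b\<in>Basis. t ^ m b * (w \<bullet> b / t) ^ m b)"
      using t by (intro prod.cong) (auto simp: power_divide)
    then show ?thesis
      by (simp add: prod.distrib k_def power_sum)
  qed
  have le1: "\<bar>w \<bullet> b / t\<bar> \<le> 1" if "\<And>b. b \<in> Basis \<Longrightarrow> \<bar>w \<bullet> b\<bar> \<le> t" "b \<in> Basis" for w b :: 'a
    using that t by (simp add: abs_divide)
  have "\<bar>(\<Prod>b\<in>Basis. (u \<bullet> b / t) ^ m b) - (\<Prod>b\<in>Basis. (v \<bullet> b / t) ^ m b)\<bar>
      \<le> (\<Sum>b\<in>Basis. \<bar>(u \<bullet> b / t) ^ m b - (v \<bullet> b / t) ^ m b\<bar>)"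
    using norm_prod_diff[of Basis "\<lambda>b. (u \<bullet> b / t) ^ m b" "\<lambda>b. (v \<bullet> b / t) ^ m b"] le1[OF u] le1[OF v]
    by (simp add: power_abs power_le_one)
  also have "\<dots> \<le> (\<Sum>b\<in>Basis. real (m b) * (norm (u - v) / t))"
  proof (rule sum_mono)
    fix b :: 'a assume b: "b \<in> Basis"
    have "\<bar>(u \<bullet> b / t) ^ m b - (v \<bullet> b / t) ^ m b\<bar> \<le> real (m b) * \<bar>u \<bullet> b / t - v \<bullet> b / t\<bar>"
      using norm_power_diff[of "u \<bullet> b / t" "v \<bullet> b / t" "m b"] le1[OF u b] le1[OF v b] by simp
    also have "\<bar>u \<bullet> b / t - v \<bullet> b / t\<bar> = \<bar>(u - v) \<bullet> b\<bar> / t"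
      using t by (simp add: inner_diff_left diff_divide_distrib[symmetric])
    also have "\<dots> \<le> norm (u - v) / t"
      using t b by (intro divide_right_mono Basis_le_norm) auto
    finally show "\<bar>(u \<bullet> b / t) ^ m b - (v \<bullet> b / t) ^ m b\<bar> \<le> real (m b) * (norm (u - v) / t)"
      by (simp add: mult_left_mono)
  qed
  also have "\<dots> = real k * (norm (u - v) / t)"
    by (simp add: k_def sum_distrib_right sum_divide_distrib)
  finally have *: "\<bar>(\<Prod>b\<in>Basis. (u \<bullet> b / t) ^ m b) - (\<Prod>b\<in>Basis. (v \<bullet> b / t) ^ m b)\<bar>
      \<le> real k * (norm (u - v) / t)" .
  have "t * \<bar>(\<Prod>b\<in>Basis. (u \<bullet> b) ^ m b) - (\<Prod>b\<in>Basis. (v \<bullet> b) ^ m b)\<bar>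
    = t * (t ^ k * \<bar>(\<Prod>b\<in>Basis. (u \<bullet> b / t) ^ m b) - (\<Prod>b\<in>Basis. (v \<bullet> b / t) ^ m b)\<bar>)"
    unfolding scale[of u] scale[of v] using t by (simp add: right_diff_distrib[symmetric] abs_mult)
  also have "\<dots> \<le> t * (t ^ k * (real k * (norm (u - v) / t)))"
    using t * by (intro mult_left_mono) auto
  also have "\<dots> = t ^ k * real k * norm (u - v)"
    using t by simp
  finally show ?thesis by (simp add: k_def)
qed

text \<open>Stated as one formula for degrees 0 and 1, so that the linear part of a power series can be
  collected without naming its coefficients.\<close>

lemma monomial_low_degree_diff:
  fixes u v :: "'a::euclidean_space"
  assumes "(\<Sum>b\<in>Basis. m b) \<le> Suc 0"
  shows "(\<Prod>b\<in>Basis. (u \<bullet> b) ^ m b) - (\<Prod>b\<in>Basis. (v \<bullet> b) ^ m b)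
    = (\<Sum>b\<in>Basis. real (m b) * ((u - v) \<bullet> b))"
proof (cases "\<forall>b\<in>Basis. m b = 0")
  case True
  then show ?thesis by simp
next
  case False
  then obtain a :: 'a where a: "a \<in> Basis" "m a \<noteq> 0" by auto
  have s: "(\<Sum>b\<in>Basis. m b) = m a + (\<Sum>b\<in>Basis - {a}. m b)"
    using a by (simp add: sum.remove)
  then have ma: "m a = 1" and "(\<Sum>b\<in>Basis - {a}. m b) = 0"
    using assms a by linarith+
  then have z: "m b = 0" if "b \<in> Basis - {a}" for b
    using that by simp
  have "(\<Prod>b\<in>Basis. (w \<bullet> b) ^ m b) = w \<bullet> a" for w :: 'a
    using a z ma by (simp add: prod.remove[of _ a])
  moreover have "(\<Sum>b\<in>Basis. real (m b) * ((u - v) \<bullet> b)) = (u - v) \<bullet> a"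
    using a z ma by (simp add: sum.remove[of _ a])
  ultimately show ?thesis by (simp add: inner_diff_left)
qed

text \<open>The monomials of degree at most one make up the linearisation. A monomial of degree
  \<open>k \<ge> 2\<close> has Lipschitz constant at most \<open>k * t ^ (k - 1)\<close> on the cube of half-width \<open>t\<close>, and for
  \<open>t \<le> \<rho> / 2\<close> this is at most \<open>t * 4 / \<rho>\<^sup>2 * \<rho> ^ k\<close>. Absolute convergence at the corner of the cube of
  half-width \<open>\<rho>\<close> therefore bounds the Lipschitz constant of the whole remainder by a multiple of
  \<open>t\<close>.\<close>

lemma real_analytic_at_imp_strict_gradient:
  fixes g :: "'a::euclidean_space \<Rightarrow> real"
  assumes "real_analytic_at g p"
  shows "\<exists>d. has_strict_gradient g d p UNIV"
proof -
  obtain c r where r: "0 < r" and series: "\<And>x. x \<in> ball p r \<Longrightarrow>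
      ((\<lambda>m. c m * (\<Prod>b\<in>Basis. ((x - p) \<bullet> b) ^ m b)) has_sum g x) (Basis \<rightarrow>\<^sub>E UNIV)"
    using assms unfolding real_analytic_at_def by blast
  define M :: "('a \<Rightarrow> nat) set" where "M = Basis \<rightarrow>\<^sub>E UNIV"
  define deg :: "('a \<Rightarrow> nat) \<Rightarrow> nat" where "deg m = (\<Sum>b\<in>Basis. m b)" for m
  define mono :: "('a \<Rightarrow> nat) \<Rightarrow> 'a \<Rightarrow> real" where "mono m u = (\<Prod>b\<in>Basis. (u \<bullet> b) ^ m b)" for m u
  \<comment> \<open>The corner of the cube of half-width \<open>\<rho>\<close> has to lie in the ball of convergence.\<close>
  define \<rho> where "\<rho> = r / (2 * real DIM('a))"
  have \<rho>: "0 < \<rho>" using r by (simp add: \<rho>_def)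
  define q :: 'a where "q = (\<Sum>b\<in>Basis. \<rho> *\<^sub>R b)"
  have qb: "q \<bullet> b = \<rho>" if "b \<in> Basis" for b
    using that by (simp add: q_def)
  have "norm q \<le> (\<Sum>b\<in>Basis. norm (\<rho> *\<^sub>R (b::'a)))"
    unfolding q_def by (rule norm_sum)
  also have "\<dots> = r / 2"
    using r by (simp add: \<rho>_def)
  finally have "p + q \<in> ball p r"
    using r by (simp add: dist_norm)
  from series[OF this] have "((\<lambda>m. c m * \<rho> ^ deg m) has_sum g (p + q)) M"
    using qb by (simp add: deg_def power_sum M_def)
  then have "(\<lambda>m. c m * \<rho> ^ deg m) summable_on M"
    by (rule has_sum_imp_summable)
  then have "(\<lambda>m. \<bar>c m\<bar> * \<rho> ^ deg m) summable_on M"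
    using \<rho> by (subst (asm) summable_on_iff_abs_summable_on_real) (simp add: abs_mult)
  then obtain S where S: "((\<lambda>m. \<bar>c m\<bar> * \<rho> ^ deg m) has_sum S) M"
    by (auto simp: summable_on_def)
  have S0: "0 \<le> S"
    using S by (rule has_sum_nonneg) (use \<rho> in auto)
  define Low where "Low = {m \<in> M. deg m \<le> Suc 0}"
  have "Low \<subseteq> Basis \<rightarrow>\<^sub>E {0, 1}"
  proof
    fix m assume m: "m \<in> Low"
    have "m b \<le> 1" if "b \<in> Basis" for b
      using m member_le_sum[OF that, of m] unfolding Low_def deg_def by auto
    then show "m \<in> Basis \<rightarrow>\<^sub>E {0, 1}"
      using m unfolding Low_def M_def by (auto simp: PiE_iff le_Suc_eq)
  qed
  then have finLow: "finite Low"
    by (rule finite_subset) (auto intro: finite_PiE)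
  define lin :: "('a \<Rightarrow> nat) \<Rightarrow> 'a \<Rightarrow> real"
    where "lin m w = (if deg m \<le> Suc 0 then \<Sum>b\<in>Basis. real (m b) * (w \<bullet> b) else 0)" for m w
  define d where "d = (\<Sum>m\<in>Low. \<Sum>b\<in>Basis. (c m * real (m b)) *\<^sub>R b)"
  have lin_sum: "((\<lambda>m. c m * lin m w) has_sum (d \<bullet> w)) M" for w
  proof (rule has_sum_finite_neutralI)
    show "finite Low" "Low \<subseteq> M" using finLow by (auto simp: Low_def)
    show "c m * lin m w = 0" if "m \<in> M - Low" for m
      using that by (auto simp: Low_def lin_def)
    have "(\<Sum>b\<in>Basis. (c m * real (m b)) *\<^sub>R b) \<bullet> w = c m * lin m w" if "m \<in> Low" for m
    proof -
      have "lin m w = (\<Sum>b\<in>Basis. real (m b) * (w \<bullet> b))"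
        using that by (simp add: Low_def lin_def)
      then show ?thesis
        by (simp only: inner_sum_left inner_scaleR_left sum_distrib_left mult.assoc inner_commute[of w])
    qed
    then show "d \<bullet> w = (\<Sum>m\<in>Low. c m * lin m w)"
      unfolding d_def inner_sum_left[of _ Low] by (rule sum.cong[OF refl])
  qed
  have R: "\<bar>mono m u - mono m v - lin m (u - v)\<bar> \<le> t * (4 / \<rho>\<^sup>2) * norm (u - v) * \<rho> ^ deg m"
    if t: "0 < t" "t \<le> \<rho> / 2" and u: "norm u \<le> t" and v: "norm v \<le> t" for m u v t
  proof (cases "deg m \<le> Suc 0")
    case True
    then have "mono m u - mono m v - lin m (u - v) = 0"
      using monomial_low_degree_diff[of m u v] by (simp add: deg_def mono_def lin_def)
    then show ?thesis using t \<rho> by simp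
  next
    case False
    define k where "k = deg m - 2"
    have k: "deg m = k + 2" using False by (simp add: k_def)
    have "\<bar>u \<bullet> b\<bar> \<le> t" "\<bar>v \<bullet> b\<bar> \<le> t" if "b \<in> Basis" for b
      using Basis_le_norm[OF that, of u] Basis_le_norm[OF that, of v] u v by linarith+
    then have "t * \<bar>mono m u - mono m v\<bar> \<le> t ^ deg m * real (deg m) * norm (u - v)"
      unfolding mono_def deg_def by (intro monomial_diff_bound t) auto
    also have "\<dots> = t * (t * t ^ k * real (deg m) * norm (u - v))"
      by (simp add: k)
    finally have "\<bar>mono m u - mono m v\<bar> \<le> t * t ^ k * real (deg m) * norm (u - v)"
      using t by simp
    also have "\<dots> \<le> t * (\<rho> / 2) ^ k * 2 ^ deg m * norm (u - v)"
    proof -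
      have "t ^ k \<le> (\<rho> / 2) ^ k" using t by (intro power_mono) auto
      then have "t * t ^ k \<le> t * (\<rho> / 2) ^ k" using t by (intro mult_left_mono) auto
      moreover have "real (deg m) \<le> 2 ^ deg m"
        by (rule less_imp_le[OF of_nat_less_two_power])
      ultimately have "t * t ^ k * real (deg m) \<le> t * (\<rho> / 2) ^ k * 2 ^ deg m"
        using t \<rho> by (intro mult_mono) auto
      then show ?thesis by (rule mult_right_mono) simp
    qed
    also have "\<dots> = t * (4 / \<rho>\<^sup>2) * norm (u - v) * \<rho> ^ deg m"
      using \<rho> by (simp add: k power_divide power_add power2_eq_square)
    finally show ?thesis using False by (simp add: lin_def)
  qed
  have main: "\<bar>g x - g y - d \<bullet> (x - y)\<bar> \<le> t * (4 / \<rho>\<^sup>2) * norm (x - y) * S"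
    if t: "0 < t" "t \<le> \<rho> / 2" and x: "norm (x - p) \<le> t" and y: "norm (y - p) \<le> t" for x y t
  proof -
    have "\<rho> \<le> r"
    proof -
      have "1 \<le> real DIM('a)" by (simp add: Suc_leI)
      then have "1 \<le> 2 * real DIM('a)" by linarith
      then have "r / (2 * real DIM('a)) \<le> r / 1"
        using r by (intro divide_left_mono) auto
      then show ?thesis by (simp add: \<rho>_def)
    qed
    then have "x \<in> ball p r" "y \<in> ball p r"
      using x y t \<rho> by (auto simp: dist_norm norm_minus_commute)
    then have "((\<lambda>m. c m * mono m (x - p)) has_sum g x) M"
      "((\<lambda>m. c m * mono m (y - p)) has_sum g y) M"
      using series unfolding mono_def M_def by blast+
    note hs = this
    have "((\<lambda>m. c m * mono m (x - p) + - (c m * mono m (y - p)) + - (c m * lin m (x - y)))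
       has_sum (g x + - g y + - (d \<bullet> (x - y)))) M"
      by (rule has_sum_add[OF has_sum_add[OF hs(1) has_sum_uminusI[OF hs(2)]] has_sum_uminusI[OF lin_sum]])
    then have *: "((\<lambda>m. c m * (mono m (x - p) - mono m (y - p) - lin m (x - y)))
       has_sum (g x - g y - d \<bullet> (x - y))) M"
      by (simp add: algebra_simps)
    have "((\<lambda>m. t * (4 / \<rho>\<^sup>2) * norm (x - y) * (\<bar>c m\<bar> * \<rho> ^ deg m)) has_sum (t * (4 / \<rho>\<^sup>2) * norm (x - y) * S)) M"
      by (intro has_sum_cmult_right S)
    then have **: "((\<lambda>m. \<bar>c m\<bar> * (t * (4 / \<rho>\<^sup>2) * norm (x - y) * \<rho> ^ deg m)) has_sum (t * (4 / \<rho>\<^sup>2) * norm (x - y) * S)) M"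
      by (simp add: mult_ac)
    have le: "\<bar>c m * (mono m (x - p) - mono m (y - p) - lin m (x - y))\<bar>
      \<le> \<bar>c m\<bar> * (t * (4 / \<rho>\<^sup>2) * norm (x - y) * \<rho> ^ deg m)" for m
    proof -
      have "\<bar>mono m (x - p) - mono m (y - p) - lin m ((x - p) - (y - p))\<bar>
          \<le> t * (4 / \<rho>\<^sup>2) * norm ((x - p) - (y - p)) * \<rho> ^ deg m"
        by (rule R[OF t x y])
      also have "(x - p) - (y - p) = x - y" by simp
      finally show ?thesis
        unfolding abs_mult by (rule mult_left_mono) simp
    qed
    have "g x - g y - d \<bullet> (x - y) \<le> t * (4 / \<rho>\<^sup>2) * norm (x - y) * S"
      using le by (intro has_sum_mono[OF * **]) (metis abs_le_D1)
    moreover have "- (g x - g y - d \<bullet> (x - y)) \<le> t * (4 / \<rho>\<^sup>2) * norm (x - y) * S"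
      using le by (intro has_sum_mono[OF has_sum_uminusI[OF *] **]) (metis abs_le_D2)
    ultimately show ?thesis by linarith
  qed
  have "has_strict_gradient g d p UNIV"
    unfolding has_strict_gradient_def
  proof (intro allI impI)
    fix e :: real assume e: "0 < e"
    define t where "t = min (\<rho> / 2) (e * \<rho>\<^sup>2 / (4 * (S + 1)))"
    have t: "0 < t" using \<rho> e S0 by (simp add: t_def)
    have t2: "t \<le> \<rho> / 2" unfolding t_def by (rule min.cobounded1)
    have "t * (4 / \<rho>\<^sup>2) * S \<le> (e * \<rho>\<^sup>2 / (4 * (S + 1))) * (4 / \<rho>\<^sup>2) * S"
      unfolding t_def using S0 by (intro mult_right_mono min.cobounded2) auto
    also have "\<dots> = e * (S / (S + 1))"
      using \<rho> S0 by (simp add: field_simps)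
    also have "\<dots> \<le> e * 1"
      using e S0 by (intro mult_left_mono) (auto simp: field_simps)
    finally have te: "t * (4 / \<rho>\<^sup>2) * S \<le> e" by simp
    have "\<bar>g u - g v - d \<bullet> (u - v)\<bar> \<le> e * norm (u - v)" if "u \<in> ball p t" "v \<in> ball p t" for u v
    proof -
      have "\<bar>g u - g v - d \<bullet> (u - v)\<bar> \<le> t * (4 / \<rho>\<^sup>2) * norm (u - v) * S"
        using that by (intro main t t2) (auto simp: dist_norm norm_minus_commute)
      also have "\<dots> = (t * (4 / \<rho>\<^sup>2) * S) * norm (u - v)" by simp
      also have "\<dots> \<le> e * norm (u - v)"
        using te by (intro mult_right_mono) auto
      finally show ?thesis .
    qed
    then show "\<exists>r>0. \<forall>u\<in>UNIV \<inter> ball p r. \<forall>v\<in>UNIV \<inter> ball p r.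
       \<bar>g u - g v - d \<bullet> (u - v)\<bar> \<le> e * norm (u - v)"
      using t by (intro exI[of _ t]) simp
  qed
  then show ?thesis ..
qed

section \<open>The projective plane and its double cover\<close>

abbreviation unit_sphere :: "(real^3) set" where "unit_sphere \<equiv> sphere 0 1"

lemma rp2_cases:
  obtains x where "x \<in> unit_sphere" "p = proj_rp2 x"
proof -
  have "antipodal_rel (rep_rp2 p) (rep_rp2 p)" "proj_rp2 (rep_rp2 p) = p"
    using Quotient3_rep_reflp[OF Quotient3_rp2] Quotient3_abs_rep[OF Quotient3_rp2] by auto
  then show thesis using that by (metis antipodal_rel_def)
qed

lemma proj_rp2_eq_iff:
  assumes "x \<in> unit_sphere" "y \<in> unit_sphere"
  shows "proj_rp2 x = proj_rp2 y \<longleftrightarrow> y = x \<or> y = - x"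
proof -
  have "antipodal_rel x y \<longleftrightarrow> proj_rp2 x = proj_rp2 y"
    using assms Quotient3_rel[OF Quotient3_rp2, of x y] by (auto simp: antipodal_rel_def)
  then show ?thesis using assms by (auto simp: antipodal_rel_def)
qed

lemma proj_rp2_minus: "x \<in> unit_sphere \<Longrightarrow> proj_rp2 (- x) = proj_rp2 x"
  by (subst proj_rp2_eq_iff) auto

text \<open>Both metrics are used: lengths of fibres are measured with the angle, while the estimates
  below are Euclidean. Since the chord is the shorter of the two, replacing the angle by the chord
  only weakens what is known about the pieces of a cover.\<close>

lemma chord_le_angle:
  fixes x y :: "'a::real_inner"
  assumes "norm x = 1" "norm y = 1"
  shows "norm (x - y) \<le> arccos (x \<bullet> y)"
proof -
  define \<theta> where "\<theta> = arccos (x \<bullet> y)"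
  have b: "\<bar>x \<bullet> y\<bar> \<le> 1" using assms by (rule abs_inner_unit_le)
  then have c: "x \<bullet> y = cos \<theta>" and \<theta>0: "0 \<le> \<theta>"
    by (auto simp: \<theta>_def cos_arccos_abs intro!: arccos_lbound)
  have "(norm (x - y))\<^sup>2 = 2 - 2 * (x \<bullet> y)"
    using assms by (simp add: norm_eq_1 power2_norm_eq_inner inner_diff_left inner_diff_right inner_commute)
  also have "\<dots> = 4 * (sin (\<theta> / 2))\<^sup>2"
    using cos_double_sin[of "\<theta> / 2"] by (simp add: c)
  also have "\<dots> \<le> 4 * (\<theta> / 2)\<^sup>2"
    using abs_sin_x_le_abs_x[of "\<theta> / 2"] by (intro mult_left_mono) (auto simp flip: abs_le_square_iff)
  also have "\<dots> = \<theta>\<^sup>2" by (simp add: power_divide)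
  finally show ?thesis
    using \<theta>0 unfolding \<theta>_def by (rule power2_le_imp_le)
qed

lemma chord_le_dist_rp2:
  assumes "x \<in> unit_sphere" "y \<in> unit_sphere"
  shows "norm (x - y) \<le> dist (proj_rp2 x) (proj_rp2 y) \<or> norm (x + y) \<le> dist (proj_rp2 x) (proj_rp2 y)"
proof -
  have "antipodal_rel x x" "antipodal_rel y y"
    using assms by (auto simp: antipodal_rel_def)
  then have "dist (proj_rp2 x) (proj_rp2 y) = min (sphere_dist x y) (sphere_dist x (- y))"
    by (rule dist_rp2.abs_eq)
  then show ?thesis
    using chord_le_angle[of x y] chord_le_angle[of x "- y"] assms
    by (auto simp: sphere_dist_def min_def)
qed

text \<open>Near a point of an open hemisphere the lift is the chart function composed with an
  orthogonal projection. That projection is linear and does not increase distances, so strict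
  differentiability is inherited, with the pulled back gradient.\<close>

lemma lift_strict_gradient:
  assumes f: "real_analytic_rp2 f" and p: "p \<in> unit_sphere"
  shows "\<exists>g. has_strict_gradient (\<lambda>x. f (proj_rp2 x)) g p unit_sphere"
proof -
  have "p \<noteq> 0" using p by auto
  then obtain k where k: "p $ k \<noteq> 0" by (auto simp: vec_eq_iff)
  define s :: real where "s = sgn (p $ k)"
  have s: "s = 1 \<or> s = -1" and pos: "0 < s * p $ k"
    using k by (auto simp: s_def sgn_if)
  define h where "h u = f (proj_rp2 (hemisphere_param s k u))" for u
  define P :: "real^3 \<Rightarrow> real^2" where "P x = vector [x $ (k + 1), x $ (k + 2)]" for x
  have kk: "k + 1 \<noteq> k" "k + 2 \<noteq> k" "k + 2 \<noteq> k + 1"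
    using exhaust_3[of k] by auto
  have param: "hemisphere_param s k (P x) = x \<and> P x \<in> ball 0 1" if "x \<in> unit_sphere" "0 < s * x $ k" for x
  proof -
    have "x \<in> hemisphere_param s k ` ball 0 1"
      using that hemisphere_param_image[OF s, of k] by auto
    then obtain u where u: "u \<in> ball 0 1" "x = hemisphere_param s k u" by auto
    have "P x = u"
      using kk by (simp add: P_def u vec_eq_iff hemisphere_param_def forall_2)
    then show ?thesis using u by simp
  qed
  have "real_analytic_at h (P p)"
    using f s param[OF p pos] unfolding real_analytic_rp2_def real_analytic_on_def h_def by auto
  then obtain d where d: "has_strict_gradient h d (P p) UNIV"
    using real_analytic_at_imp_strict_gradient by blast
  define g :: "real^3" where "g = axis (k + 1) (d $ 1) + axis (k + 2) (d $ 2)"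
  have gP: "g \<bullet> w = d \<bullet> P w" for w
    by (simp add: g_def P_def inner_add_left inner_axis' inner_vec_def[of d] sum_2)
  have Pdiff: "P u - P v = P (u - v)" for u v
    by (simp add: P_def vec_eq_iff forall_2)
  have Pnorm: "norm (P w) \<le> norm w" for w
  proof -
    have "(norm (P w))\<^sup>2 = (w $ (k + 1))\<^sup>2 + (w $ (k + 2))\<^sup>2"
      unfolding power2_norm_eq_inner by (simp add: inner_vec_def sum_2 P_def power2_eq_square)
    also have "\<dots> \<le> (norm w)\<^sup>2"
      unfolding power2_norm_eq_inner by (simp add: inner_vec_def sum_UNIV_3_cyclic[of _ k] power2_eq_square)
    finally show ?thesis by (rule power2_le_imp_le) simp
  qed
  have "has_strict_gradient (\<lambda>x. f (proj_rp2 x)) g p unit_sphere"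
    unfolding has_strict_gradient_def
  proof (intro allI impI)
    fix e :: real assume e: "0 < e"
    then obtain r where r: "r > 0" and R: "\<And>u v. u \<in> ball (P p) r \<Longrightarrow> v \<in> ball (P p) r \<Longrightarrow>
        \<bar>h u - h v - d \<bullet> (u - v)\<bar> \<le> e * norm (u - v)"
      using d unfolding has_strict_gradient_def by fastforce
    define r' where "r' = min r \<bar>p $ k\<bar>"
    have r': "0 < r'" using r k by (simp add: r'_def)
    have near: "hemisphere_param s k (P x) = x \<and> P x \<in> ball (P p) r"
      if x: "x \<in> unit_sphere" "x \<in> ball p r'" for x
    proof
      have "\<bar>(p - x) $ k\<bar> \<le> norm (p - x)" by (rule component_le_norm_cart)
      then have "\<bar>p $ k - x $ k\<bar> < \<bar>p $ k\<bar>"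
        using x by (simp add: r'_def dist_norm)
      then have "0 < s * x $ k"
        using k by (auto simp: s_def sgn_if)
      then show "hemisphere_param s k (P x) = x" using param x by blast
      show "P x \<in> ball (P p) r"
        using x Pnorm[of "p - x"] by (simp add: dist_norm Pdiff r'_def)
    qed
    have "\<bar>f (proj_rp2 u) - f (proj_rp2 v) - g \<bullet> (u - v)\<bar> \<le> e * norm (u - v)"
      if "u \<in> unit_sphere" "u \<in> ball p r'" "v \<in> unit_sphere" "v \<in> ball p r'" for u v
    proof -
      have "\<bar>h (P u) - h (P v) - d \<bullet> (P u - P v)\<bar> \<le> e * norm (P u - P v)"
        using near that by (intro R) auto
      also have "\<dots> \<le> e * norm (u - v)"
        using e Pnorm by (simp add: Pdiff mult_left_mono)
      finally show ?thesis
        using near[of u] near[of v] that by (simp add: h_def gP Pdiff)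
    qed
    then show "\<exists>r>0. \<forall>u\<in>unit_sphere \<inter> ball p r. \<forall>v\<in>unit_sphere \<inter> ball p r.
       \<bar>f (proj_rp2 u) - f (proj_rp2 v) - g \<bullet> (u - v)\<bar> \<le> e * norm (u - v)"
      using r' by blast
  qed
  then show ?thesis ..
qed

text \<open>A secant of the sphere is orthogonal to the sum of its end points, hence nearly orthogonal
  to any nearby point \<open>p\<close>.\<close>

lemma sphere_secant_normal_le:
  fixes p u v :: "'a::real_inner"
  assumes "norm u = 1" "norm v = 1" "u \<in> ball p r" "v \<in> ball p r"
  shows "\<bar>p \<bullet> (u - v)\<bar> \<le> r * norm (u - v)"
proof -
  have "(u + v) \<bullet> (u - v) = 0"
    using assms unfolding norm_eq_1 by (simp add: inner_add_left inner_diff_right inner_commute[of v u])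
  then have "2 * (p \<bullet> (u - v)) = (p - u) \<bullet> (u - v) + (p - v) \<bullet> (u - v)"
    by (simp add: inner_add_left inner_diff_left)
  moreover have near: "\<bar>(p - w) \<bullet> (u - v)\<bar> \<le> r * norm (u - v)" if "w \<in> ball p r" for w
  proof -
    have "\<bar>(p - w) \<bullet> (u - v)\<bar> \<le> norm (p - w) * norm (u - v)" by (rule Cauchy_Schwarz_ineq2)
    also have "\<dots> \<le> r * norm (u - v)"
      using that by (intro mult_right_mono) (auto simp: dist_norm)
    finally show ?thesis .
  qed
  ultimately show ?thesis
    using near[OF assms(3)] near[OF assms(4)] by linarith
qed

text \<open>The radial part of a gradient is invisible on the sphere, because secants near \<open>p\<close> are
  nearly orthogonal to \<open>p\<close>.\<close>

lemma strict_gradient_tangential: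
  fixes F :: "'a::real_inner \<Rightarrow> real"
  assumes g: "has_strict_gradient F g p (sphere 0 1)"
  shows "has_strict_gradient F (g - (g \<bullet> p) *\<^sub>R p) p (sphere 0 1)"
  unfolding has_strict_gradient_def
proof (intro allI impI)
  fix e :: real assume e: "0 < e"
  then obtain r where r: "r > 0" and R: "\<And>u v. u \<in> sphere 0 1 \<inter> ball p r \<Longrightarrow> v \<in> sphere 0 1 \<inter> ball p r \<Longrightarrow>
      \<bar>F u - F v - g \<bullet> (u - v)\<bar> \<le> e / 2 * norm (u - v)"
    using g half_gt_zero[OF e] unfolding has_strict_gradient_def by meson
  define c where "c = \<bar>g \<bullet> p\<bar> + 1"
  have c: "0 < c" by (simp add: c_def)
  define r' where "r' = min r (e / (2 * c))"
  have r': "0 < r'" using r e c by (simp add: r'_def)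
  have "\<bar>F u - F v - (g - (g \<bullet> p) *\<^sub>R p) \<bullet> (u - v)\<bar> \<le> e * norm (u - v)"
    if uv: "u \<in> sphere 0 1 \<inter> ball p r'" "v \<in> sphere 0 1 \<inter> ball p r'" for u v
  proof -
    have "\<bar>p \<bullet> (u - v)\<bar> \<le> r' * norm (u - v)"
      using uv by (intro sphere_secant_normal_le) auto
    also have "\<dots> \<le> e / (2 * c) * norm (u - v)"
      by (intro mult_right_mono) (auto simp: r'_def)
    finally have "\<bar>g \<bullet> p\<bar> * \<bar>p \<bullet> (u - v)\<bar> \<le> c * (e / (2 * c) * norm (u - v))"
      by (intro mult_mono) (use e c in \<open>auto simp: c_def\<close>)
    then have "\<bar>(g \<bullet> p) * (p \<bullet> (u - v))\<bar> \<le> e / 2 * norm (u - v)"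
      using c by (simp add: abs_mult)
    moreover have "\<bar>F u - F v - g \<bullet> (u - v)\<bar> \<le> e / 2 * norm (u - v)"
      using uv by (intro R) (auto simp: r'_def)
    moreover have "(g - (g \<bullet> p) *\<^sub>R p) \<bullet> (u - v) = g \<bullet> (u - v) - (g \<bullet> p) * (p \<bullet> (u - v))"
      by (simp only: inner_diff_left inner_scaleR_left)
    ultimately show ?thesis by linarith
  qed
  then show "\<exists>r>0. \<forall>u\<in>sphere 0 1 \<inter> ball p r. \<forall>v\<in>sphere 0 1 \<inter> ball p r.
     \<bar>F u - F v - (g - (g \<bullet> p) *\<^sub>R p) \<bullet> (u - v)\<bar> \<le> e * norm (u - v)"
    using r' by blast
qed

lemma strict_gradient_imp_continuous_on:
  assumes "\<And>p. p \<in> S \<Longrightarrow> \<exists>g. has_strict_gradient F g p S"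
  shows "continuous_on S F"
  unfolding continuous_on_iff
proof (intro ballI allI impI)
  fix p and e :: real assume p: "p \<in> S" and e: "0 < e"
  obtain g where "has_strict_gradient F g p S" using assms p by blast
  then obtain r where r: "r > 0" and R: "\<And>u v. u \<in> S \<inter> ball p r \<Longrightarrow> v \<in> S \<inter> ball p r \<Longrightarrow>
      \<bar>F u - F v - g \<bullet> (u - v)\<bar> \<le> 1 * norm (u - v)"
    unfolding has_strict_gradient_def by (meson zero_less_one)
  define \<delta> where "\<delta> = min r (e / (norm g + 1))"
  have ng: "0 < norm g + 1" by (simp add: add_nonneg_pos)
  have \<delta>: "0 < \<delta>" using r e ng by (simp add: \<delta>_def)
  have "dist (F u) (F p) < e" if u: "u \<in> S" "dist u p < \<delta>" for u
  proof -
    have "\<bar>F u - F p - g \<bullet> (u - p)\<bar> \<le> 1 * norm (u - p)"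
      using u p r by (intro R) (auto simp: \<delta>_def dist_commute)
    moreover have "\<bar>g \<bullet> (u - p)\<bar> \<le> norm g * norm (u - p)" by (rule Cauchy_Schwarz_ineq2)
    ultimately have "\<bar>F u - F p\<bar> \<le> (norm g + 1) * norm (u - p)"
      by (simp add: distrib_right)
    also have "\<dots> < e"
    proof -
      have "norm (u - p) < e / (norm g + 1)" using u by (simp add: \<delta>_def dist_norm)
      then show ?thesis using ng by (simp add: field_simps)
    qed
    finally show ?thesis by (simp add: dist_real_def)
  qed
  then show "\<exists>d>0. \<forall>x'\<in>S. dist x' p < d \<longrightarrow> dist (F x') (F p) < e"
    using \<delta> by blast
qed

section \<open>Points where level sets are almost straight\<close>

text \<open>All secants of the level sets of \<open>F\<close> inside the ball are almost parallel to one line, the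
  orthogonal complement of the frame \<open>z, \<nu>\<close>, with slope at most \<open>\<eta>\<close>; and \<open>z\<close> is almost the
  position vector. For \<open>\<eta> = 1\<close> the two slope conditions say nothing, which allows a cruder
  estimate, valid at every point, to be a special case of the sharp one.\<close>

definition flat_ball :: "(real^3 \<Rightarrow> real) \<Rightarrow> real \<Rightarrow> real^3 \<Rightarrow> real \<Rightarrow> bool" where
  "flat_ball F \<eta> p r \<longleftrightarrow> (\<exists>z \<nu>. norm z = 1 \<and> norm \<nu> = 1 \<and> z \<bullet> \<nu> = 0 \<and>
     (\<forall>u\<in>unit_sphere \<inter> ball p r. 1 - \<eta> / 2 \<le> z \<bullet> u) \<and>
     (\<forall>u\<in>unit_sphere \<inter> ball p r. \<forall>v\<in>unit_sphere \<inter> ball p r. F u = F v \<longrightarrow>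
        \<bar>\<nu> \<bullet> (u - v)\<bar> \<le> \<eta> * norm (u - v) \<and> \<bar>z \<bullet> (u - v)\<bar> \<le> \<eta> * norm (u - v)))"

definition flat_points :: "(real^3 \<Rightarrow> real) \<Rightarrow> real \<Rightarrow> (real^3) set" where
  "flat_points F \<eta> = {p. \<exists>r>0. flat_ball F \<eta> p r}"

lemma flat_ball_mono:
  assumes "flat_ball F \<eta> p r" "ball q s \<subseteq> ball p r"
  shows "flat_ball F \<eta> q s"
proof -
  have "unit_sphere \<inter> ball q s \<subseteq> unit_sphere \<inter> ball p r" using assms by blast
  with assms(1) show ?thesis unfolding flat_ball_def by (meson subsetD)
qed

lemma open_flat_points: "open (flat_points F \<eta>)"
  unfolding open_contains_ball
proof
  fix p assume "p \<in> flat_points F \<eta>"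
  then obtain r where r: "r > 0" "flat_ball F \<eta> p r"
    unfolding flat_points_def by blast
  have "q \<in> flat_points F \<eta>" if q: "q \<in> ball p (r / 2)" for q
  proof -
    have "ball q (r / 2) \<subseteq> ball p r"
    proof
      fix u assume "u \<in> ball q (r / 2)"
      then show "u \<in> ball p r"
        using q dist_triangle[of p u q] by simp
    qed
    then show ?thesis
      using flat_ball_mono[OF r(2)] half_gt_zero[OF r(1)] unfolding flat_points_def by blast
  qed
  then show "\<exists>e>0. ball p e \<subseteq> flat_points F \<eta>"
    using r by (intro exI[of _ "r / 2"]) auto
qed

lemma sphere_inner_near:
  fixes p u :: "'a::real_inner"
  assumes "norm p = 1" "norm u = 1" "0 < \<eta>" "u \<in> ball p (min 1 \<eta>)"
  shows "1 - \<eta> / 2 \<le> p \<bullet> u"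
proof -
  have d: "norm (p - u) < 1" "norm (p - u) < \<eta>" using assms by (auto simp: dist_norm)
  have "(norm (p - u))\<^sup>2 = 2 - 2 * (p \<bullet> u)"
    using assms by (simp add: norm_eq_1 power2_norm_eq_inner inner_diff_left inner_diff_right inner_commute)
  moreover have "(norm (p - u))\<^sup>2 \<le> \<eta>"
  proof -
    have "norm (p - u) * norm (p - u) \<le> 1 * \<eta>"
      using d by (intro mult_mono) auto
    then show ?thesis by (simp add: power2_eq_square)
  qed
  ultimately show ?thesis by linarith
qed

text \<open>The crude case: the slope bounds are the Cauchy-Schwarz inequality.\<close>

lemma sphere_subset_flat_points_1: "unit_sphere \<subseteq> flat_points F 1"
proof
  fix p :: "real^3" assume p: "p \<in> unit_sphere"
  obtain \<nu> :: "real^3" where \<nu>: "norm \<nu> = 1" "p \<bullet> \<nu> = 0"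
  proof -
    obtain w :: "real^3" where "w \<noteq> 0" "orthogonal p w"
      using orthogonal_to_vector_exists[of p] by auto
    then show thesis
      using that[of "w /\<^sub>R norm w"] by (auto simp: orthogonal_def)
  qed
  have CS: "\<bar>w \<bullet> (u - v)\<bar> \<le> 1 * norm (u - v)" if "norm w = 1" for u v w :: "real^3"
    using Cauchy_Schwarz_ineq2[of w "u - v"] that by simp
  have "\<forall>u\<in>unit_sphere \<inter> ball p 1. 1 - 1 / 2 \<le> p \<bullet> u"
    using sphere_inner_near[of p _ 1] p by auto
  then show "p \<in> flat_points F 1"
    unfolding flat_points_def flat_ball_def using p \<nu> CS[of p] CS[of \<nu>] zero_less_one
    by (intro CollectI exI[of _ "1::real"] exI[of _ p] exI[of _ \<nu>] conjI) auto
qed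

text \<open>If \<open>F u = F v\<close>, then strict differentiability makes \<open>g \<bullet> (u - v)\<close> small compared with
  \<open>norm (u - v)\<close>; so level sets run orthogonally to the gradient, up to an arbitrarily small angle.\<close>

lemma gradient_imp_flat_point:
  assumes p: "p \<in> unit_sphere" and g: "has_strict_gradient F g p unit_sphere"
    and tang: "g \<bullet> p = 0" and nz: "g \<noteq> 0" and \<eta>: "0 < \<eta>"
  shows "p \<in> flat_points F \<eta>"
proof -
  have ng: "0 < norm g" using nz by simp
  then have "0 < \<eta> * norm g" using \<eta> by simp
  then obtain r where r: "r > 0" and R: "\<And>u v. u \<in> unit_sphere \<inter> ball p r \<Longrightarrow> v \<in> unit_sphere \<inter> ball p r \<Longrightarrow>
      \<bar>F u - F v - g \<bullet> (u - v)\<bar> \<le> (\<eta> * norm g) * norm (u - v)"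
    using g unfolding has_strict_gradient_def by meson
  define r' where "r' = min r (min 1 \<eta>)"
  have r': "0 < r'" using r \<eta> by (simp add: r'_def)
  define \<nu> where "\<nu> = g /\<^sub>R norm g"
  have "norm \<nu> = 1" "p \<bullet> \<nu> = 0" "norm p = 1"
    using ng tang p by (auto simp: \<nu>_def inner_commute)
  moreover have "\<forall>u\<in>unit_sphere \<inter> ball p r'. 1 - \<eta> / 2 \<le> p \<bullet> u"
    using sphere_inner_near[of p _ \<eta>] p \<eta> by (auto simp: r'_def)
  moreover have "\<bar>\<nu> \<bullet> (u - v)\<bar> \<le> \<eta> * norm (u - v) \<and> \<bar>p \<bullet> (u - v)\<bar> \<le> \<eta> * norm (u - v)"
    if uv: "u\<in>unit_sphere \<inter> ball p r'" "v\<in>unit_sphere \<inter> ball p r'" "F u = F v" for u v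
  proof
    have "\<bar>g \<bullet> (u - v)\<bar> \<le> (\<eta> * norm g) * norm (u - v)"
      using R[of u v] uv by (auto simp: r'_def)
    then have "\<bar>g \<bullet> (u - v)\<bar> / norm g \<le> \<eta> * norm (u - v)"
      using ng by (simp add: field_simps)
    then show "\<bar>\<nu> \<bullet> (u - v)\<bar> \<le> \<eta> * norm (u - v)"
      using ng by (simp add: \<nu>_def abs_mult divide_inverse mult.commute)
    show "\<bar>p \<bullet> (u - v)\<bar> \<le> \<eta> * norm (u - v)"
      using uv by (intro sphere_secant_normal_le) (auto simp: r'_def)
  qed
  ultimately show ?thesis
    unfolding flat_points_def flat_ball_def using r' by blast
qed

section \<open>The volume of the set of lines that meet a thin box\<close>

lemma Basis_triple: "(Basis :: (real \<times> real \<times> real) set) = {(1, 0, 0), (0, 1, 0), (0, 0, 1)}"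
  by (auto simp: Basis_prod_def zero_prod_def)

text \<open>The coordinate map of an orthonormal frame is inverse to an orthogonal transformation.\<close>

lemma orthonormal_frame:
  fixes a b c :: "real^3"
  assumes unit: "norm a = 1" "norm b = 1" "norm c = 1"
    and orth: "a \<bullet> b = 0" "a \<bullet> c = 0" "b \<bullet> c = 0"
  defines "Q \<equiv> \<lambda>w::real^3. w $ 1 *\<^sub>R a + w $ 2 *\<^sub>R b + w $ 3 *\<^sub>R c"
  shows "orthogonal_transformation Q"
    and "a \<bullet> Q w = w $ 1" "b \<bullet> Q w = w $ 2" "c \<bullet> Q w = w $ 3"
    and "x \<bullet> y = (a \<bullet> x) * (a \<bullet> y) + (b \<bullet> x) * (b \<bullet> y) + (c \<bullet> x) * (c \<bullet> y)"
proof -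
  have sq: "a \<bullet> a = 1" "b \<bullet> b = 1" "c \<bullet> c = 1" using unit by (auto simp: norm_eq_1)
  have dots: "a \<bullet> Q w = w $ 1" "b \<bullet> Q w = w $ 2" "c \<bullet> Q w = w $ 3" for w
    using sq orth by (simp_all add: Q_def inner_add_right inner_commute[of b a] inner_commute[of c a] inner_commute[of c b])
  then show "a \<bullet> Q w = w $ 1" "b \<bullet> Q w = w $ 2" "c \<bullet> Q w = w $ 3" by auto
  have sum3: "v \<bullet> w = v $ 1 * w $ 1 + v $ 2 * w $ 2 + v $ 3 * w $ 3" for v w :: "real^3"
    by (simp add: inner_vec_def sum_3)
  have QQ: "Q v \<bullet> Q w = v \<bullet> w" for v w
  proof -
    have "Q v \<bullet> Q w = v $ 1 * (a \<bullet> Q w) + v $ 2 * (b \<bullet> Q w) + v $ 3 * (c \<bullet> Q w)"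
      by (subst Q_def) (simp only: inner_add_left inner_scaleR_left)
    then show ?thesis by (simp only: dots sum3[of v w])
  qed
  moreover have "linear Q"
    unfolding Q_def by (intro linearI) (auto simp: algebra_simps)
  ultimately show orth': "orthogonal_transformation Q"
    by (simp add: orthogonal_transformation_def)
  then have "surj Q" by (rule orthogonal_transformation_surj)
  then obtain v w where "x = Q v" "y = Q w" by (metis surjD)
  then show "x \<bullet> y = (a \<bullet> x) * (a \<bullet> y) + (b \<bullet> x) * (b \<bullet> y) + (c \<bullet> x) * (c \<bullet> y)"
    by (simp only: dots QQ sum3[of v w])
qed

text \<open>Rotation invariance of volume in the form that Fubini needs: the coordinates with respect to
  an orthonormal frame of \<open>real^3\<close> carry Lebesgue measure to Lebesgue measure on the product
  \<open>real \<times> real \<times> real\<close>.\<close>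

lemma lborel_distr_orthonormal_frame:
  fixes a b c :: "real^3"
  assumes unit: "norm a = 1" "norm b = 1" "norm c = 1"
    and orth: "a \<bullet> b = 0" "a \<bullet> c = 0" "b \<bullet> c = 0"
  shows "distr lborel borel (\<lambda>n. (a \<bullet> n, b \<bullet> n, c \<bullet> n)) = (lborel :: (real \<times> real \<times> real) measure)"
proof (rule lborel_eqI[symmetric])
  define T where "T n = (a \<bullet> n, b \<bullet> n, c \<bullet> n)" for n
  have T [measurable]: "T \<in> borel_measurable borel"
    unfolding T_def by measurable
  define O' :: "real^3 \<Rightarrow> real^3" where "O' = (\<lambda>w. w $ 1 *\<^sub>R a + w $ 2 *\<^sub>R b + w $ 3 *\<^sub>R c)"
  have orth': "orthogonal_transformation O'"
    and dots: "a \<bullet> O' w = w $ 1" "b \<bullet> O' w = w $ 2" "c \<bullet> O' w = w $ 3" for w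
    unfolding O'_def by (rule orthonormal_frame[OF unit orth])+
  have surj: "surj O'" using orth' by (rule orthogonal_transformation_surj)
  fix l u :: "real \<times> real \<times> real"
  assume lu: "\<And>b. b \<in> Basis \<Longrightarrow> l \<bullet> b \<le> u \<bullet> b"
  obtain l1 l2 l3 where l: "l = (l1, l2, l3)" by (cases l)
  obtain u1 u2 u3 where u: "u = (u1, u2, u3)" by (cases u)
  define l' u' :: "real^3" where "l' = vector [l1, l2, l3]" and "u' = vector [u1, u2, u3]"
  have le: "l1 \<le> u1" "l2 \<le> u2" "l3 \<le> u3"
    using lu[of "(1, 0, 0)"] lu[of "(0, 1, 0)"] lu[of "(0, 0, 1)"] by (auto simp: Basis_triple l u)
  have memT: "T n \<in> box l u \<longleftrightarrow> l1 < a \<bullet> n \<and> a \<bullet> n < u1 \<and> l2 < b \<bullet> n \<and> b \<bullet> n < u2 \<and> l3 < c \<bullet> n \<and> c \<bullet> n < u3" for n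
    by (auto simp: mem_box Basis_triple l u T_def)
  have mem': "w \<in> box l' u' \<longleftrightarrow> l1 < w $ 1 \<and> w $ 1 < u1 \<and> l2 < w $ 2 \<and> w $ 2 < u2 \<and> l3 < w $ 3 \<and> w $ 3 < u3" for w
    by (auto simp: mem_box_cart forall_3 l'_def u'_def)
  have eq: "T -` box l u = O' ` box l' u'"
  proof (intro equalityI subsetI)
    fix n assume n: "n \<in> T -` box l u"
    obtain w where w: "n = O' w" using surj by (metis surjD)
    then have "w \<in> box l' u'" using n by (simp add: memT mem' dots)
    with w show "n \<in> O' ` box l' u'" by blast
  qed (auto simp: memT mem' dots)
  have "emeasure (distr lborel borel T) (box l u) = emeasure lborel (O' ` box l' u')"
    by (subst emeasure_distr) (auto simp: eq)
  also have "\<dots> = emeasure lebesgue (O' ` box l' u')"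
  proof -
    have "T -` box l u \<inter> space borel \<in> sets borel"
      by (rule measurable_sets[OF T]) auto
    then show ?thesis by (simp add: eq emeasure_completion)
  qed
  also have "\<dots> = ennreal (measure lebesgue (O' ` box l' u'))"
    by (intro emeasure_eq_measure2 fmeasurableD2 measurable_orthogonal_image[OF orth'] lmeasurable_box)
  also have "measure lebesgue (O' ` box l' u') = measure lebesgue (box l' u')"
    by (intro measure_orthogonal_image[OF orth'] lmeasurable_box)
  also have "measure lebesgue (box l' u') = (u1 - l1) * (u2 - l2) * (u3 - l3)"
  proof -
    have "measure lebesgue (box l' u') = (\<Prod>i\<in>UNIV. u' $ i - l' $ i)"
    proof -
      have "cbox l' u' \<noteq> {}"
        using le by (auto simp: interval_ne_empty_cart forall_3 l'_def u'_def)
      then have "measure lborel (cbox l' u') = (\<Prod>i\<in>UNIV. u' $ i - l' $ i)"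
        by (rule content_cbox_cart)
      moreover have "measure lebesgue (box l' u') = measure lborel (box l' u')"
        by (rule measure_completion) simp
      moreover have "measure lborel (box l' u') = measure lborel (cbox l' u')"
        by (simp only: measure_lborel_box_eq measure_lborel_cbox_eq)
      ultimately show ?thesis by simp
    qed
    also have "\<dots> = (u1 - l1) * (u2 - l2) * (u3 - l3)"
      unfolding UNIV_3 by (simp add: l'_def u'_def)
    finally show ?thesis .
  qed
  also have "\<dots> = (\<Prod>b\<in>Basis. (u - l) \<bullet> b)"
    by (simp add: Basis_triple l u)
  finally show "emeasure (distr lborel borel (\<lambda>n. (a \<bullet> n, b \<bullet> n, c \<bullet> n))) (box l u) = ennreal (\<Prod>b\<in>Basis. (u - l) \<bullet> b)"
    by (simp add: T_def)
qed simp

text \<open>The integral of the first coordinate's modulus over the unit disc. Divided by the volume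
  \<open>4 * pi / 3\<close> of the ball it gives \<open>1 / pi\<close>, which is the constant in Crofton's formula.\<close>

lemma has_integral_abs_mult_chord:
  "((\<lambda>x::real. 2 * \<bar>x\<bar> * sqrt (1 - x\<^sup>2)) has_integral (4 / 3)) {-1..1}"
proof -
  define G where "G x = (2 / 3) * ((1 - x\<^sup>2) * sqrt (1 - x\<^sup>2))" for x :: real
  have contG: "continuous_on A G" for A
    unfolding G_def by (intro continuous_intros)
  have derG: "(G has_real_derivative (- 2 * x * sqrt (1 - x\<^sup>2))) (at x)" if "-1 < x" "x < 1" for x
  proof -
    have pos: "0 < 1 - x\<^sup>2" using that by (simp add: abs_square_less_1)
    then have s: "sqrt (1 - x\<^sup>2) * sqrt (1 - x\<^sup>2) = 1 - x\<^sup>2" "sqrt (1 - x\<^sup>2) \<noteq> 0" by auto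
    show ?thesis
      unfolding G_def using pos s
      by (auto intro!: derivative_eq_intros simp: field_simps)
  qed
  have "((\<lambda>x. - 2 * x * sqrt (1 - x\<^sup>2)) has_integral (G 0 - G (-1))) {-1..0}"
    using contG derG by (intro fundamental_theorem_of_calculus_interior)
      (auto simp flip: has_real_derivative_iff_has_vector_derivative)
  then have neg: "((\<lambda>x. 2 * \<bar>x\<bar> * sqrt (1 - x\<^sup>2)) has_integral (2 / 3)) {-1..0}"
    by (rule has_integral_eq[rotated, THEN has_integral_eq_rhs]) (auto simp: G_def)
  have "((\<lambda>x. - (- 2 * x * sqrt (1 - x\<^sup>2))) has_integral (- (G 1 - G 0))) {0..1}"
    using contG derG by (intro has_integral_neg fundamental_theorem_of_calculus_interior)
      (auto simp flip: has_real_derivative_iff_has_vector_derivative)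
  then have pos: "((\<lambda>x. 2 * \<bar>x\<bar> * sqrt (1 - x\<^sup>2)) has_integral (2 / 3)) {0..1}"
    by (rule has_integral_eq[rotated, THEN has_integral_eq_rhs]) (auto simp: G_def)
  show ?thesis
    using has_integral_combine[OF _ _ neg pos] by simp
qed

text \<open>The slab lies over the unit disc of the \<open>(a, b)\<close> plane and its fibre in direction \<open>c\<close> is an
  interval of length \<open>(d * \<bar>a\<bar> + 4 * \<eta> * d) / C\<close>. Integration of the first summand gives exactly
  \<open>4 / 3 * d / C\<close>; the second is an error term, in which the chord length of the disc is simply
  replaced by 2.\<close>

lemma emeasure_slab_over_disc_le:
  fixes A B C d \<eta> :: real
  assumes C: "0 < C" and d: "0 \<le> d" and \<eta>: "0 \<le> \<eta>"
  shows "emeasure lborel {(a, b, c). a\<^sup>2 + b\<^sup>2 \<le> 1 \<and> \<bar>A * a + B * b + C * c\<bar> \<le> d / 2 * \<bar>a\<bar> + 2 * \<eta> * d}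
    \<le> ennreal (d * ((4 / 3 + 16 * \<eta>) / C))"
proof -
  define w where "w a = d / 2 * \<bar>a\<bar> + 2 * \<eta> * d" for a
  have w0: "0 \<le> w a" for a using d \<eta> by (simp add: w_def)
  define X where "X = {(a, b, c). a\<^sup>2 + b\<^sup>2 \<le> 1 \<and> \<bar>A * a + B * b + C * c\<bar> \<le> w a}"
  have "closed {x :: real \<times> real \<times> real. (fst x)\<^sup>2 + (fst (snd x))\<^sup>2 \<le> 1 \<and>
      \<bar>A * fst x + B * fst (snd x) + C * snd (snd x)\<bar> \<le> w (fst x)}"
    unfolding w_def by (intro closed_Collect_conj closed_Collect_le continuous_intros)
  then have "closed X" by (simp add: X_def case_prod_unfold)
  then have X: "X \<in> sets borel" by (rule borel_closed)
  have secA: "closed (Pair a -` X)" for a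
    using \<open>closed X\<close> by (intro closed_vimage continuous_intros)
  have inner: "emeasure lborel (Pair b -` (Pair a -` X)) \<le> ennreal (2 * w a / C) * indicator {- sqrt (1 - a\<^sup>2)..sqrt (1 - a\<^sup>2)} b"
    for a b
  proof (cases "a\<^sup>2 + b\<^sup>2 \<le> 1")
    case True
    then have "b\<^sup>2 \<le> 1 - a\<^sup>2" by linarith
    then have "\<bar>b\<bar> \<le> sqrt (1 - a\<^sup>2)" by (metis real_sqrt_abs real_sqrt_le_mono)
    then have b: "b \<in> {- sqrt (1 - a\<^sup>2)..sqrt (1 - a\<^sup>2)}" by auto
    have "Pair b -` (Pair a -` X) \<subseteq> {(- w a - A * a - B * b) / C .. (w a - A * a - B * b) / C}"
      using C by (auto simp: X_def field_simps)
    then have "emeasure lborel (Pair b -` (Pair a -` X)) \<le> emeasure lborel {(- w a - A * a - B * b) / C .. (w a - A * a - B * b) / C}"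
      by (rule emeasure_mono) simp
    also have "\<dots> = ennreal (2 * w a / C)"
      using C w0[of a] by (subst emeasure_lborel_Icc) (auto simp: divide_right_mono diff_divide_distrib[symmetric])
    finally show ?thesis using b by simp
  next
    case False
    then have "Pair b -` (Pair a -` X) = {}" by (auto simp: X_def)
    then show ?thesis by simp
  qed
  have middle: "emeasure lborel (Pair a -` X)
      \<le> ennreal (indicator {-1..1} a * (d / C * (2 * \<bar>a\<bar> * sqrt (1 - a\<^sup>2)) + 8 * \<eta> * d / C))" for a
  proof (cases "\<bar>a\<bar> \<le> 1")
    case True
    then have a2: "0 \<le> 1 - a\<^sup>2" by (simp add: abs_square_le_1)
    have "emeasure lborel (Pair a -` X) = (\<integral>\<^sup>+b. emeasure lborel (Pair b -` (Pair a -` X)) \<partial>lborel)"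
    proof -
      have "Pair a -` X \<in> sets (lborel \<Otimes>\<^sub>M (lborel :: real measure))"
        using borel_closed[OF secA] by (simp only: lborel_prod sets_lborel)
      then show ?thesis
        by (subst lborel_prod[symmetric]) (rule lborel.emeasure_pair_measure_alt)
    qed
    also have "\<dots> \<le> (\<integral>\<^sup>+b. ennreal (2 * w a / C) * indicator {- sqrt (1 - a\<^sup>2)..sqrt (1 - a\<^sup>2)} b \<partial>lborel)"
      by (intro nn_integral_mono inner)
    also have "\<dots> = ennreal (2 * w a / C) * ennreal (2 * sqrt (1 - a\<^sup>2))"
      using a2 by (simp add: nn_integral_cmult_indicator)
    also have "\<dots> = ennreal (2 * w a / C * (2 * sqrt (1 - a\<^sup>2)))"
      using w0[of a] C by (intro ennreal_mult'[symmetric]) auto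
    also have "2 * w a / C * (2 * sqrt (1 - a\<^sup>2)) =
        d / C * (2 * \<bar>a\<bar> * sqrt (1 - a\<^sup>2)) + 8 * \<eta> * d / C * sqrt (1 - a\<^sup>2)"
      using C by (simp add: w_def field_simps)
    also have "ennreal \<dots> \<le> ennreal (d / C * (2 * \<bar>a\<bar> * sqrt (1 - a\<^sup>2)) + 8 * \<eta> * d / C * 1)"
      using C d \<eta> a2 by (intro ennreal_leI add_left_mono mult_left_mono) auto
    finally show ?thesis using True by (simp add: abs_le_iff)
  next
    case False
    then have "\<not> a\<^sup>2 + b\<^sup>2 \<le> 1" for b
      using abs_square_le_1[of a] zero_le_power2[of b] by linarith
    then have "Pair a -` X = {}" by (auto simp: X_def)
    then show ?thesis by simp
  qed
  have "((\<lambda>a. d / C * (2 * \<bar>a\<bar> * sqrt (1 - a\<^sup>2)) + 8 * \<eta> * d / C) has_integral (d / C * (4 / 3) + 16 * \<eta> * d / C)) {-1..1}"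
    using has_integral_add[OF has_integral_mult_right[OF has_integral_abs_mult_chord, of "d / C"]
        has_integral_const_real[of "8 * \<eta> * d / C" "-1" 1]]
    by (rule has_integral_eq_rhs) simp
  then have int: "(\<integral>\<^sup>+a. ennreal (indicator {-1..1} a * (d / C * (2 * \<bar>a\<bar> * sqrt (1 - a\<^sup>2)) + 8 * \<eta> * d / C)) \<partial>lborel)
     = ennreal (d / C * (4 / 3) + 16 * \<eta> * d / C)"
    using C d \<eta> by (intro nn_integral_has_integral_lebesgue) (auto simp: abs_square_le_1 abs_le_iff)
  have "emeasure lborel X = (\<integral>\<^sup>+a. emeasure lborel (Pair a -` X) \<partial>lborel)"
  proof -
    have "X \<in> sets (lborel \<Otimes>\<^sub>M (lborel :: (real \<times> real) measure))"
      using X by (simp only: lborel_prod sets_lborel)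
    then show ?thesis
      by (subst lborel_prod[symmetric]) (rule lborel.emeasure_pair_measure_alt)
  qed
  also have "\<dots> \<le> (\<integral>\<^sup>+a. ennreal (indicator {-1..1} a * (d / C * (2 * \<bar>a\<bar> * sqrt (1 - a\<^sup>2)) + 8 * \<eta> * d / C)) \<partial>lborel)"
    by (intro nn_integral_mono middle)
  also have "\<dots> = ennreal (d * ((4 / 3 + 16 * \<eta>) / C))"
    unfolding int using C by (simp add: field_simps)
  finally show ?thesis by (simp add: X_def w_def)
qed

text \<open>The local form of Crofton's inequality. If \<open>n\<close> is orthogonal to some point of \<open>W\<close>, compare
  that point with the centre of a box around \<open>W\<close>: in the frame \<open>\<tau>, \<nu>, z\<close> this confines \<open>n\<close> to a slab
  around a plane, of thickness about \<open>d * \<bar>\<tau> \<bullet> n\<bar>\<close>. As the box is long only in direction \<open>\<tau>\<close>, the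
  volume is asymptotically \<open>4 / 3 * d\<close>, the value for a segment of length \<open>d\<close>. For a general set of
  diameter \<open>d\<close> one could only expect a constant worse by the factor \<open>pi / 2\<close>.\<close>

lemma emeasure_normals_meeting_box_le:
  fixes W :: "(real^3) set" and z \<nu> :: "real^3"
  assumes frame: "norm z = 1" "norm \<nu> = 1" "z \<bullet> \<nu> = 0"
    and \<eta>: "0 \<le> \<eta>" "\<eta> \<le> 1" and d: "0 \<le> d"
    and high: "\<And>x. x \<in> W \<Longrightarrow> 1 - \<eta> / 2 \<le> z \<bullet> x"
    and diam: "\<And>x y. x \<in> W \<Longrightarrow> y \<in> W \<Longrightarrow> norm (x - y) \<le> d"
    and thin: "\<And>x y. x \<in> W \<Longrightarrow> y \<in> W \<Longrightarrow> \<bar>\<nu> \<bullet> (x - y)\<bar> \<le> \<eta> * d \<and> \<bar>z \<bullet> (x - y)\<bar> \<le> \<eta> * d"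
  shows "\<exists>H\<in>sets borel. emeasure lborel H \<le> ennreal ((4 / 3 + 16 * \<eta>) / (1 - \<eta> / 2)) * ennreal d \<and>
    (\<forall>n\<in>ball 0 1. (\<exists>x\<in>W. n \<bullet> x = 0) \<longrightarrow> n \<in> H)"
proof (cases "W = {}")
  case True
  then show ?thesis by (intro bexI[of _ "{}"]) auto
next
  case False
  then obtain p where p: "p \<in> W" by blast
  define \<tau> where "\<tau> = cross3 z \<nu>"
  have \<tau>1: "norm \<tau> = 1"
  proof -
    have "(norm \<tau>)\<^sup>2 = 1" using norm_cross_dot[of z \<nu>] frame by (simp add: \<tau>_def)
    then show ?thesis by (simp add: power2_eq_1_iff) (use norm_ge_zero[of \<tau>] in linarith)
  qed
  have \<tau>: "\<tau> \<bullet> \<nu> = 0" "\<tau> \<bullet> z = 0"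
    by (simp_all add: \<tau>_def dot_cross_self)
  define T where "T n = (\<tau> \<bullet> n, \<nu> \<bullet> n, z \<bullet> n)" for n
  have dT: "distr lborel borel T = (lborel :: (real \<times> real \<times> real) measure)"
    unfolding T_def using frame \<tau> \<tau>1
    by (intro lborel_distr_orthonormal_frame) (auto simp: inner_commute)
  have T [measurable]: "T \<in> borel_measurable borel"
    unfolding T_def by measurable
  have expand: "n \<bullet> x = (\<tau> \<bullet> n) * (\<tau> \<bullet> x) + (\<nu> \<bullet> n) * (\<nu> \<bullet> x) + (z \<bullet> n) * (z \<bullet> x)" for n x
    using frame \<tau> \<tau>1 by (intro orthonormal_frame(5)) (auto simp: inner_commute)
  have unit_le: "\<bar>e \<bullet> n\<bar> \<le> norm n" if "norm e = 1" for e n :: "real^3"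
    using Cauchy_Schwarz_ineq2[of e n] that by simp
  define lo hi where "lo = (INF x\<in>W. \<tau> \<bullet> x)" and "hi = (SUP x\<in>W. \<tau> \<bullet> x)"
  have range: "\<tau> \<bullet> x \<le> \<tau> \<bullet> y + d" if "x \<in> W" "y \<in> W" for x y
    using unit_le[OF \<tau>1, of "x - y"] diam[OF that] by (simp add: inner_diff_right)
  have "bdd_above ((\<lambda>x. \<tau> \<bullet> x) ` W)"
    using range[OF _ p] by (intro bdd_aboveI2)
  then have hi: "\<tau> \<bullet> x \<le> hi" if "x \<in> W" for x
    unfolding hi_def using that by (intro cSUP_upper)
  have "bdd_below ((\<lambda>x. \<tau> \<bullet> x) ` W)"
    using range[OF p] by (intro bdd_belowI2[of _ "\<tau> \<bullet> p - d"]) (simp add: diff_le_eq)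
  then have lo: "lo \<le> \<tau> \<bullet> x" if "x \<in> W" for x
    unfolding lo_def using that by (intro cINF_lower)
  have "hi \<le> lo + d"
    unfolding hi_def
  proof (rule cSUP_least[OF False])
    fix x assume x: "x \<in> W"
    have "\<tau> \<bullet> x - d \<le> lo"
      unfolding lo_def using range[OF x] by (intro cINF_greatest[OF False]) (simp add: diff_le_eq)
    then show "\<tau> \<bullet> x \<le> lo + d" by simp
  qed
  \<comment> \<open>The centre of the box: the midpoint in direction \<open>\<tau>\<close>, an arbitrary point of \<open>W\<close> otherwise.\<close>
  define A B C where "A = (lo + hi) / 2" and "B = \<nu> \<bullet> p" and "C = z \<bullet> p"
  have A: "\<bar>A - \<tau> \<bullet> x\<bar> \<le> d / 2" if "x \<in> W" for x
    using lo[OF that] hi[OF that] \<open>hi \<le> lo + d\<close> by (auto simp: A_def abs_le_iff field_simps)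
  have C: "1 - \<eta> / 2 \<le> C" using high[OF p] by (simp add: C_def)
  then have C0: "0 < C" using \<eta> by simp
  define X where "X = {(a, b, c). a\<^sup>2 + b\<^sup>2 \<le> 1 \<and> \<bar>A * a + B * b + C * c\<bar> \<le> d / 2 * \<bar>a\<bar> + 2 * \<eta> * d}"
  have "closed {x :: real \<times> real \<times> real. (fst x)\<^sup>2 + (fst (snd x))\<^sup>2 \<le> 1 \<and>
      \<bar>A * fst x + B * fst (snd x) + C * snd (snd x)\<bar> \<le> d / 2 * \<bar>fst x\<bar> + 2 * \<eta> * d}"
    by (intro closed_Collect_conj closed_Collect_le continuous_intros)
  then have X: "X \<in> sets borel" by (intro borel_closed) (simp add: X_def case_prod_unfold)
  define H where "H = T -` X"
  have H: "H \<in> sets borel"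
    using measurable_sets[OF T X] by (simp add: H_def)
  have "emeasure lborel H = emeasure (distr lborel borel T) X"
    using X by (subst emeasure_distr) (auto simp: H_def)
  also have "\<dots> = emeasure lborel X" by (simp add: dT)
  also have "\<dots> \<le> ennreal (d * ((4 / 3 + 16 * \<eta>) / C))"
    unfolding X_def by (rule emeasure_slab_over_disc_le[OF C0 d \<eta>(1)])
  also have "\<dots> \<le> ennreal (d * ((4 / 3 + 16 * \<eta>) / (1 - \<eta> / 2)))"
    using C C0 d \<eta> by (intro ennreal_leI mult_left_mono divide_left_mono) auto
  also have "\<dots> = ennreal ((4 / 3 + 16 * \<eta>) / (1 - \<eta> / 2)) * ennreal d"
    using d \<eta> by (subst ennreal_mult[symmetric]) (auto simp: mult.commute)
  finally have vol: "emeasure lborel H \<le> ennreal ((4 / 3 + 16 * \<eta>) / (1 - \<eta> / 2)) * ennreal d" .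
  have "n \<in> H" if n: "n \<in> ball 0 1" and x: "x \<in> W" and nx: "n \<bullet> x = 0" for n x
  proof -
    have n1: "norm n \<le> 1" using n by simp
    have "(\<tau> \<bullet> n)\<^sup>2 + (\<nu> \<bullet> n)\<^sup>2 \<le> n \<bullet> n"
      using expand[of n n] by (simp add: power2_eq_square)
    also have "\<dots> \<le> 1"
      using n1 by (simp add: dot_square_norm power_le_one)
    finally have disc: "(\<tau> \<bullet> n)\<^sup>2 + (\<nu> \<bullet> n)\<^sup>2 \<le> 1" .
    have mixed: "\<bar>u * v\<bar> \<le> \<eta> * d" if "\<bar>u\<bar> \<le> \<eta> * d" "\<bar>v\<bar> \<le> 1" for u v :: real
      using mult_mono[OF that] d \<eta> by (simp add: abs_mult)
    have "A * (\<tau> \<bullet> n) + B * (\<nu> \<bullet> n) + C * (z \<bullet> n)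
        = (A - \<tau> \<bullet> x) * (\<tau> \<bullet> n) + (B - \<nu> \<bullet> x) * (\<nu> \<bullet> n) + (C - z \<bullet> x) * (z \<bullet> n)"
      using expand[of n x] nx by (simp add: algebra_simps)
    moreover have "\<bar>(A - \<tau> \<bullet> x) * (\<tau> \<bullet> n)\<bar> \<le> d / 2 * \<bar>\<tau> \<bullet> n\<bar>"
      unfolding abs_mult by (intro mult_right_mono A x) simp
    moreover have "\<bar>(B - \<nu> \<bullet> x) * (\<nu> \<bullet> n)\<bar> \<le> \<eta> * d" "\<bar>(C - z \<bullet> x) * (z \<bullet> n)\<bar> \<le> \<eta> * d"
      using thin[OF p x] unit_le[of \<nu> n] unit_le[of z n] frame n1
      by (auto intro!: mixed simp: B_def C_def inner_diff_right)
    ultimately have "\<bar>A * (\<tau> \<bullet> n) + B * (\<nu> \<bullet> n) + C * (z \<bullet> n)\<bar> \<le> d / 2 * \<bar>\<tau> \<bullet> n\<bar> + 2 * \<eta> * d"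
      by linarith
    with disc show ?thesis by (simp add: H_def X_def T_def)
  qed
  with H vol show ?thesis by blast
qed

section \<open>Length is bounded below by intersection numbers\<close>

text \<open>The transfer of the box estimate to a piece \<open>U\<close> of a cover of a fibre. The preimage of a
  small set under the projection consists of two opposite copies; \<open>W\<close> is the copy close to one chosen
  lift, and it suffices because orthogonality to \<open>n\<close> does not distinguish \<open>x\<close> from \<open>- x\<close>. The
  centre and radius of the flat ball may depend on the point: any single flat ball of radius larger
  than the diameter contains all of \<open>W\<close>.\<close>

lemma normals_meeting_small_piece:
  fixes f :: "rp2 \<Rightarrow> real"
  defines "F \<equiv> \<lambda>x. f (proj_rp2 x)"
  assumes \<eta>: "0 < \<eta>" "\<eta> \<le> 1" and U: "bounded U" "diameter U \<le> 1 / 2"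
  shows "\<exists>H\<in>sets borel.
    emeasure lborel H \<le> ennreal ((4 / 3 + 16 * \<eta>) / (1 - \<eta> / 2)) * ennreal (diameter U) \<and>
    (\<forall>n\<in>ball 0 1. \<forall>x\<in>unit_sphere. \<forall>r. diameter U < r \<and> flat_ball F \<eta> x r \<and>
       proj_rp2 x \<in> U \<and> F x = y \<and> n \<bullet> x = 0 \<longrightarrow> n \<in> H)"
proof (cases "\<exists>p\<in>unit_sphere. \<exists>r. diameter U < r \<and> flat_ball F \<eta> p r \<and> proj_rp2 p \<in> U \<and> F p = y")
  case False
  then show ?thesis by (intro bexI[of _ "{}"]) auto
next
  case True
  then obtain p r where p: "p \<in> unit_sphere" "proj_rp2 p \<in> U" "F p = y"
    and r: "diameter U < r" and flat: "flat_ball F \<eta> p r" by blast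
  define d where "d = diameter U"
  have d: "0 \<le> d" "d \<le> 1 / 2" using U by (auto simp: d_def diameter_ge_0)
  have near: "norm (u - v) \<le> d \<or> norm (u + v) \<le> d"
    if "u \<in> unit_sphere" "v \<in> unit_sphere" "proj_rp2 u \<in> U" "proj_rp2 v \<in> U" for u v
    using chord_le_dist_rp2[OF that(1,2)] diameter_bounded_bound[OF U(1) that(3,4)]
    unfolding d_def by linarith
  define W where "W = {x \<in> unit_sphere. proj_rp2 x \<in> U \<and> F x = y \<and> norm (x - p) \<le> d}"
  have diamW: "norm (u - v) \<le> d" if "u \<in> W" "v \<in> W" for u v
  proof (rule ccontr)
    assume "\<not> norm (u - v) \<le> d"
    then have "norm (u + v) \<le> d" using near[of u v] that by (auto simp: W_def)
    moreover have "norm (u - v) \<le> norm (u - p) + norm (v - p)"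
      using norm_triangle_ineq4[of "u - p" "v - p"] by simp
    moreover have "norm (2 *\<^sub>R u) \<le> norm (u + v) + norm (u - v)"
      using norm_triangle_ineq[of "u + v" "u - v"] by (simp add: scaleR_2)
    ultimately show False using that d by (simp add: W_def)
  qed
  obtain z \<nu> where frame: "norm z = 1" "norm \<nu> = 1" "z \<bullet> \<nu> = 0"
    and high: "\<And>u. u \<in> unit_sphere \<inter> ball p r \<Longrightarrow> 1 - \<eta> / 2 \<le> z \<bullet> u"
    and thin: "\<And>u v. u \<in> unit_sphere \<inter> ball p r \<Longrightarrow> v \<in> unit_sphere \<inter> ball p r \<Longrightarrow> F u = F v \<Longrightarrow>
        \<bar>\<nu> \<bullet> (u - v)\<bar> \<le> \<eta> * norm (u - v) \<and> \<bar>z \<bullet> (u - v)\<bar> \<le> \<eta> * norm (u - v)"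
    using flat unfolding flat_ball_def by blast
  have W: "u \<in> unit_sphere \<inter> ball p r \<and> F u = y" if "u \<in> W" for u
    using that r by (auto simp: W_def d_def dist_norm norm_minus_commute)
  have thinW: "\<bar>\<nu> \<bullet> (u - v)\<bar> \<le> \<eta> * d \<and> \<bar>z \<bullet> (u - v)\<bar> \<le> \<eta> * d" if "u \<in> W" "v \<in> W" for u v
  proof -
    have "\<eta> * norm (u - v) \<le> \<eta> * d"
      using diamW[OF that] \<eta> by (intro mult_left_mono) auto
    then show ?thesis using thin[of u v] W that by force
  qed
  obtain H where H: "H \<in> sets borel"
    "emeasure lborel H \<le> ennreal ((4 / 3 + 16 * \<eta>) / (1 - \<eta> / 2)) * ennreal d"
    "\<And>n. n \<in> ball 0 1 \<Longrightarrow> (\<exists>x\<in>W. n \<bullet> x = 0) \<Longrightarrow> n \<in> H"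
    using emeasure_normals_meeting_box_le[OF frame _ \<eta>(2) d(1), of W] \<eta> high W diamW thinW by fastforce
  have "n \<in> H" if "n \<in> ball 0 1" "x \<in> unit_sphere" "proj_rp2 x \<in> U" "F x = y" "n \<bullet> x = 0" for n x
  proof -
    have "- x \<in> W" if "norm (x + p) \<le> d"
    proof -
      have "norm (- x - p) = norm (x + p)" by (metis minus_add_distrib norm_minus_cancel uminus_add_conv_diff diff_conv_add_uminus)
      then show ?thesis
        using that \<open>x \<in> unit_sphere\<close> \<open>proj_rp2 x \<in> U\<close> \<open>F x = y\<close> proj_rp2_minus[of x] by (simp add: W_def F_def)
    qed
    then have "x \<in> W \<or> - x \<in> W"
      using near[of x p] p that by (auto simp: W_def)
    then show ?thesis using that by (intro H(3)) (auto intro: bexI[of _ x] bexI[of _ "- x"])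
  qed
  then show ?thesis using H(1,2) unfolding d_def by blast
qed

text \<open>The lower bound on length by counting intersections with lines. Take covers of the fibre
  with mesh tending to 0. A fixed line \<open>n\<close> meets the fibre in \<open>N\<close> distinct flat points; once the mesh
  is smaller than their mutual distances and their radii of flatness, they lie in \<open>N\<close> different
  pieces, each of which counts in the estimate for small pieces. So the number of sets \<open>H k i\<close>
  containing \<open>n\<close> is eventually at least \<open>N\<close>, and Fatou's lemma turns this into a bound for the
  integral. The mesh threshold may depend on \<open>n\<close>, because Fatou's lemma asks only
  for bounds that hold eventually at each point.\<close>

lemma crofton_lower_bound:
  fixes f :: "rp2 \<Rightarrow> real"
  assumes \<eta>: "0 < \<eta>" "\<eta> \<le> 1" and G: "G \<in> sets borel" "G \<subseteq> ball 0 1"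
    and hits: "\<And>n. n \<in> G \<Longrightarrow> \<exists>P. finite P \<and> card P = N \<and>
      (\<forall>p\<in>P. \<exists>x\<in>unit_sphere. proj_rp2 x = p \<and> n \<bullet> x = 0 \<and> f p = y \<and> x \<in> flat_points (\<lambda>x. f (proj_rp2 x)) \<eta>)"
  shows "of_nat N * emeasure lborel G
    \<le> ennreal ((4 / 3 + 16 * \<eta>) / (1 - \<eta> / 2)) * hausdorff1 (f -` {y})"
proof -
  define c where "c = (4 / 3 + 16 * \<eta>) / (1 - \<eta> / 2)"
  have c: "0 < c" using \<eta> by (simp add: c_def)
  define h where "h = hausdorff1 (f -` {y})"
  define F where "F = (\<lambda>x. f (proj_rp2 x))"
  define \<delta> where "\<delta> k = inverse (real (Suc (Suc k)))" for k
  have \<delta>: "0 < \<delta> k" "\<delta> k \<le> 1 / 2" for k by (auto simp: \<delta>_def field_simps)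
  have \<delta>0: "\<delta> \<longlonglongrightarrow> 0" unfolding \<delta>_def by (rule LIMSEQ_Suc[OF LIMSEQ_inverse_real_of_nat])
  have bound: "of_nat N * emeasure lborel G \<le> ennreal c * (h + ennreal e)" if h: "h < top" and e: "0 < e" for e
  proof -
    have "\<exists>U. f -` {y} \<subseteq> (\<Union>i. U i) \<and> (\<forall>i::nat. bounded (U i) \<and> diameter (U i) \<le> \<delta> k) \<and>
        (\<Sum>i. ennreal (diameter (U i))) < h + ennreal e" for k
    proof -
      have "hausdorff1_pre (\<delta> k) (f -` {y}) \<le> h"
        unfolding h_def hausdorff1_def by (rule SUP_upper) (use \<delta> in auto)
      also have "h < h + ennreal e"
        using h e by (simp add: ennreal_lessI less_top)
      finally show ?thesis
        unfolding hausdorff1_pre_def INF_less_iff by blast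
    qed
    then obtain U where cover: "\<And>k. f -` {y} \<subseteq> (\<Union>i::nat. U k i)"
      and bdd: "\<And>k i. bounded (U k i)" and small: "\<And>k i. diameter (U k i) \<le> \<delta> k"
      and total: "\<And>k. (\<Sum>i. ennreal (diameter (U k i))) < h + ennreal e"
      by metis
    have "\<exists>H\<in>sets borel. emeasure lborel H \<le> ennreal c * ennreal (diameter (U k i)) \<and>
      (\<forall>n\<in>ball 0 1. \<forall>x\<in>unit_sphere. \<forall>r. diameter (U k i) < r \<and> flat_ball F \<eta> x r \<and>
       proj_rp2 x \<in> U k i \<and> F x = y \<and> n \<bullet> x = 0 \<longrightarrow> n \<in> H)" for k i
      unfolding c_def F_def
      using small[of k i] \<delta>(2)[of k] by (intro normals_meeting_small_piece \<eta> bdd) linarith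
    then obtain H where H: "\<And>k i. H k i \<in> sets borel"
      and volH: "\<And>k i. emeasure lborel (H k i) \<le> ennreal c * ennreal (diameter (U k i))"
      and meetH: "\<And>k i n x r. n \<in> ball 0 1 \<Longrightarrow> x \<in> unit_sphere \<Longrightarrow> diameter (U k i) < r \<Longrightarrow> flat_ball F \<eta> x r \<Longrightarrow>
         proj_rp2 x \<in> U k i \<Longrightarrow> F x = y \<Longrightarrow> n \<bullet> x = 0 \<Longrightarrow> n \<in> H k i"
      by metis
    define s where "s k n = (\<Sum>i. indicator (H k i) n :: ennreal)" for k n
    have s [measurable]: "s k \<in> borel_measurable borel" for k
      unfolding s_def using H by measurable
    have "of_nat N \<le> liminf (\<lambda>k. s k n)" if n: "n \<in> G" for n
    proof -
      define hit where "hit p x r \<longleftrightarrow> x \<in> unit_sphere \<and> 0 < r \<and> proj_rp2 x = p \<and>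
          n \<bullet> x = 0 \<and> f p = y \<and> flat_ball F \<eta> x r" for p x r
      obtain P where P: "finite P" "card P = N" and "\<And>p. p \<in> P \<Longrightarrow> \<exists>x r. hit p x r"
      proof -
        obtain P where P: "finite P" "card P = N" and ex: "\<forall>p\<in>P. \<exists>x\<in>unit_sphere. proj_rp2 x = p \<and> n \<bullet> x = 0 \<and> f p = y \<and>
            x \<in> flat_points (\<lambda>x. f (proj_rp2 x)) \<eta>"
          using hits[OF n] by (elim exE conjE)
        have "\<exists>x r. hit p x r" if p: "p \<in> P" for p
        proof -
          from bspec[OF ex p] obtain x where x: "x \<in> unit_sphere" "proj_rp2 x = p \<and> n \<bullet> x = 0 \<and> f p = y \<and>
            x \<in> flat_points (\<lambda>x. f (proj_rp2 x)) \<eta>" by (elim bexE)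
          then obtain r where "0 < r" "flat_ball F \<eta> x r"
            unfolding flat_points_def F_def by (elim conjE CollectE exE)
          with x have "hit p x r" unfolding hit_def by simp
          then show ?thesis by (intro exI)
        qed
        then show thesis by (rule that[OF P])
      qed
      then obtain x r where "\<And>p. p \<in> P \<Longrightarrow> hit p (x p) (r p)"
        by metis
      then have xr: "\<And>p. p \<in> P \<Longrightarrow> x p \<in> unit_sphere \<and> 0 < r p \<and> proj_rp2 (x p) = p \<and>
          n \<bullet> x p = 0 \<and> f p = y \<and> flat_ball F \<eta> (x p) (r p)"
        unfolding hit_def .
      define D where "D = insert 1 (r ` P \<union> {dist p q | p q. p \<in> P \<and> q \<in> P \<and> p \<noteq> q})"
      have "{dist p q | p q. p \<in> P \<and> q \<in> P \<and> p \<noteq> q} \<subseteq> (\<lambda>(p, q). dist p q) ` (P \<times> P)" by auto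
      then have "finite {dist p q | p q. p \<in> P \<and> q \<in> P \<and> p \<noteq> q}"
        by (rule finite_subset) (use P(1) in simp)
      then have "finite D" using P(1) by (simp add: D_def)
      \<comment> \<open>Below this mesh the points of \<open>P\<close> are separated and each piece is shorter than the flat radius.\<close>
      define \<rho> where "\<rho> = Min D"
      have \<rho>: "0 < \<rho>" using \<open>finite D\<close> xr by (auto simp: \<rho>_def D_def)
      have \<rho>r: "\<rho> \<le> r p" if "p \<in> P" for p
        unfolding \<rho>_def using \<open>finite D\<close> that by (intro Min_le) (auto simp: D_def)
      have \<rho>d: "\<rho> \<le> dist p q" if "p \<in> P" "q \<in> P" "p \<noteq> q" for p q
        unfolding \<rho>_def using \<open>finite D\<close> that by (intro Min_le) (auto simp: D_def)
      have "\<forall>\<^sub>F k in sequentially. \<delta> k < \<rho>"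
        using order_tendstoD(2)[OF \<delta>0 \<rho>] .
      then have "\<forall>\<^sub>F k in sequentially. of_nat N \<le> s k n"
      proof eventually_elim
        case (elim k)
        have "\<exists>i. p \<in> U k i" if "p \<in> P" for p
          using cover[of k] xr[OF that] by blast
        then obtain j where j: "\<And>p. p \<in> P \<Longrightarrow> p \<in> U k (j p)" by metis
        have inj: "inj_on j P"
        proof (rule inj_onI, rule ccontr)
          fix p q assume pq: "p \<in> P" "q \<in> P" "j p = j q" "p \<noteq> q"
          then have "dist p q \<le> diameter (U k (j p))"
            using j by (intro diameter_bounded_bound bdd) metis+
          then show False
            using small[of k "j p"] elim \<rho>d[of p q] pq by linarith
        qed
        have in_H: "n \<in> H k (j p)" if p: "p \<in> P" for p
        proof (rule meetH)
          show "n \<in> ball 0 1" using n G by blast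
          show "x p \<in> unit_sphere" "flat_ball F \<eta> (x p) (r p)" "n \<bullet> x p = 0" using xr[OF p] by auto
          show "diameter (U k (j p)) < r p" using small[of k "j p"] elim \<rho>r[OF p] by linarith
          show "proj_rp2 (x p) \<in> U k (j p)" "F (x p) = y" using xr[OF p] j[OF p] by (auto simp: F_def)
        qed
        have "of_nat N = (\<Sum>i\<in>j ` P. indicator (H k i) n :: ennreal)"
        proof -
          have "(\<Sum>i\<in>j ` P. indicator (H k i) n :: ennreal) = (\<Sum>i\<in>j ` P. 1)"
            using in_H by (intro sum.cong) auto
          then show ?thesis using P inj by (simp add: card_image)
        qed
        also have "\<dots> \<le> s k n"
          unfolding s_def using P by (intro sum_le_suminf) auto
        finally show ?case .
      qed
      then show ?thesis by (rule Liminf_bounded)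
    qed
    then have "of_nat N * indicator G n \<le> liminf (\<lambda>k. s k n)" for n
      by (cases "n \<in> G") auto
    then have "(\<integral>\<^sup>+n. of_nat N * indicator G n \<partial>lborel) \<le> (\<integral>\<^sup>+n. liminf (\<lambda>k. s k n) \<partial>lborel)"
      by (intro nn_integral_mono)
    also have "\<dots> \<le> liminf (\<lambda>k. \<integral>\<^sup>+n. s k n \<partial>lborel)"
      by (intro nn_integral_liminf) simp
    also have "\<dots> \<le> liminf (\<lambda>k::nat. ennreal c * (h + ennreal e))"
    proof (intro Liminf_mono always_eventually allI)
      fix k
      have "(\<integral>\<^sup>+n. s k n \<partial>lborel) = (\<Sum>i. emeasure lborel (H k i))"
        unfolding s_def using H by (subst nn_integral_suminf) auto
      also have "\<dots> \<le> (\<Sum>i. ennreal c * ennreal (diameter (U k i)))"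
        using volH by (intro suminf_le) auto
      also have "\<dots> = ennreal c * (\<Sum>i. ennreal (diameter (U k i)))"
        by simp
      also have "\<dots> \<le> ennreal c * (h + ennreal e)"
        using total[of k] by (intro mult_left_mono) auto
      finally show "(\<integral>\<^sup>+n. s k n \<partial>lborel) \<le> ennreal c * (h + ennreal e)" .
    qed
    also have "\<dots> = ennreal c * (h + ennreal e)" by (simp add: Liminf_const)
    also have "(\<integral>\<^sup>+n. of_nat N * indicator G n \<partial>lborel) = of_nat N * emeasure lborel G"
      using G by (subst nn_integral_cmult_indicator) auto
    finally show ?thesis .
  qed
  have "of_nat N * emeasure lborel G \<le> ennreal c * h"
  proof (rule ennreal_le_epsilon)
    fix e :: real assume fin: "ennreal c * h < top" and e: "0 < e"
    have "h < top" using fin c by (auto simp: ennreal_mult_less_top)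
    then have "of_nat N * emeasure lborel G \<le> ennreal c * (h + ennreal (e / c))"
      using e c by (intro bound) auto
    also have "\<dots> = ennreal c * h + ennreal e"
      using e c by (simp add: distrib_left flip: ennreal_mult')
    finally show "of_nat N * emeasure lborel G \<le> ennreal c * h + ennreal e" .
  qed
  then show ?thesis by (simp add: c_def h_def)
qed

section \<open>Almost all intersections are flat\<close>

text \<open>The theorem of Sard in dimension one, obtained from its version for \<open>real^1\<close>.\<close>

lemma negligible_critical_values:
  fixes h :: "real \<Rightarrow> real"
  assumes "\<And>t. t \<in> T \<Longrightarrow> (h has_real_derivative 0) (at t)"
  shows "negligible (h ` T)"
proof -
  define D :: "(real^1) set" where "D = {v. v $ 1 \<in> T}"
  define g :: "real^1 \<Rightarrow> real^1" where "g v = h (v $ 1) *\<^sub>R axis 1 1" for v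
  have der: "(g has_derivative (\<lambda>_. 0)) (at v within D)" if v: "v \<in> D" for v
  proof -
    have "(*) (0::real) = (\<lambda>_. 0)" by auto
    then have "(h has_derivative (\<lambda>_. 0)) (at (v $ 1))"
      using assms v by (auto simp: has_field_derivative_def D_def)
    moreover have "((\<lambda>v::real^1. v $ 1) has_derivative (\<lambda>v. v $ 1)) (at v within D)"
      by (intro bounded_linear.has_derivative[OF bounded_linear_vec_nth] has_derivative_ident)
    ultimately have "((\<lambda>v. h (v $ 1)) has_derivative (\<lambda>_. 0)) (at v within D)"
      by (rule has_derivative_compose[rotated])
    from has_derivative_scaleR_left[OF this, of "axis 1 1 :: real^1"]
    show ?thesis by (simp add: g_def[abs_def])
  qed
  have "negligible (g ` D)"
  proof (rule baby_Sard[OF _ der])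
    show "rank (matrix (\<lambda>_::real^1. 0 :: real^1)) < CARD(1)"
      by (simp add: matrix_def zero_vec_def[symmetric] rank_0)
  qed auto
  then have "negligible ((\<lambda>v. v $ 1) ` g ` D)"
  proof (rule negligible_locally_Lipschitz_image[rotated])
    fix v :: "real^1"
    show "\<exists>U B. open U \<and> v \<in> U \<and> (\<forall>w\<in>g ` D \<inter> U. norm (w $ 1 - v $ 1) \<le> B * norm (w - v))"
      by (intro exI[of _ UNIV] exI[of _ 1]) (auto simp flip: vector_minus_component intro: component_le_norm_cart)
  qed simp
  moreover have "h ` T \<subseteq> (\<lambda>v. v $ 1) ` g ` D"
  proof
    fix y assume "y \<in> h ` T"
    then obtain t where "t \<in> T" "y = h t" by blast
    then have "(vec t :: real^1) \<in> D" "y = g (vec t) $ 1" by (auto simp: D_def g_def)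
    then show "y \<in> (\<lambda>v. v $ 1) ` g ` D" by blast
  qed
  ultimately show ?thesis by (rule negligible_subset)
qed

definition circle_point :: "real^3 \<Rightarrow> real^3 \<Rightarrow> real \<Rightarrow> real^3" where
  "circle_point a b t = cos t *\<^sub>R a + sin t *\<^sub>R b"

text \<open>The great circle orthogonal to \<open>n\<close>, parametrised with a prescribed starting point \<open>a\<close>.\<close>

lemma great_circle:
  fixes n a :: "real^3"
  assumes n: "n \<noteq> 0" and a: "norm a = 1" "n \<bullet> a = 0"
  obtains b where "norm b = 1" "a \<bullet> b = 0" "n \<bullet> b = 0"
    "\<And>t. circle_point a b t \<in> unit_sphere \<and> n \<bullet> circle_point a b t = 0"
    "\<And>x. x \<in> unit_sphere \<Longrightarrow> n \<bullet> x = 0 \<Longrightarrow> \<exists>t. 0 \<le> t \<and> t < 2 * pi \<and> x = circle_point a b t"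
proof -
  define c where "c = n /\<^sub>R norm n"
  have c: "norm c = 1" "c \<bullet> a = 0" using n a by (auto simp: c_def)
  define b where "b = cross3 c a"
  have b1: "norm b = 1"
  proof -
    have "(norm b)\<^sup>2 = 1" using norm_cross_dot[of c a] c a by (simp add: b_def)
    then show ?thesis by (simp add: power2_eq_1_iff) (use norm_ge_zero[of b] in linarith)
  qed
  have ab: "a \<bullet> b = 0" and cb: "c \<bullet> b = 0" by (simp_all add: b_def dot_cross_self)
  have n_iff: "n \<bullet> x = 0 \<longleftrightarrow> c \<bullet> x = 0" for x using n by (simp add: c_def)
  have frame: "x \<bullet> y = (a \<bullet> x) * (a \<bullet> y) + (b \<bullet> x) * (b \<bullet> y) + (c \<bullet> x) * (c \<bullet> y)" for x y
    using a(1) b1 c ab cb by (intro orthonormal_frame(5)) (auto simp: inner_commute)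
  have coords: "a \<bullet> circle_point a b t = cos t" "b \<bullet> circle_point a b t = sin t" "c \<bullet> circle_point a b t = 0" for t
    using a(1) b1 c ab cb
    by (simp_all add: circle_point_def inner_add_right norm_eq_1 inner_commute[of b a])
  have on: "circle_point a b t \<in> unit_sphere \<and> n \<bullet> circle_point a b t = 0" for t
  proof -
    have "circle_point a b t \<bullet> circle_point a b t = 1"
      by (subst frame) (simp add: coords flip: power2_eq_square)
    then show ?thesis by (simp add: norm_eq_1 n_iff coords)
  qed
  have onto: "\<exists>t. 0 \<le> t \<and> t < 2 * pi \<and> x = circle_point a b t" if x: "x \<in> unit_sphere" "n \<bullet> x = 0" for x
  proof -
    have cx: "c \<bullet> x = 0" using x n_iff by simp
    have "(a \<bullet> x)\<^sup>2 + (b \<bullet> x)\<^sup>2 = 1"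
      using frame[of x x] x cx by (simp add: norm_eq_1 power2_eq_square)
    then obtain t where t: "0 \<le> t" "t < 2 * pi" "a \<bullet> x = cos t" "b \<bullet> x = sin t"
      by (rule sincos_total_2pi)
    define w where "w = x - circle_point a b t"
    have "w \<bullet> w = 0"
      by (subst frame) (simp add: w_def inner_diff_right coords t cx)
    then have "x = circle_point a b t" by (simp add: w_def)
    with t show ?thesis by blast
  qed
  show thesis using that b1 ab on onto n_iff cb by blast
qed

lemma unit_normal_exists:
  obtains a :: "real^3" where "norm a = 1" "n \<bullet> a = 0"
proof -
  obtain w :: "real^3" where "w \<noteq> 0" "orthogonal n w"
    using orthogonal_to_vector_exists[of n] by auto
  then show thesis
    using that[of "w /\<^sub>R norm w"] by (auto simp: orthogonal_def)
qed

lemma continuous_circle_point: "continuous_on A (circle_point a b)"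
  unfolding circle_point_def by (intro continuous_intros)

lemma critical_on_great_circle:
  assumes grad: "has_strict_gradient F 0 (circle_point a b t) unit_sphere"
    and on: "\<And>t. circle_point a b t \<in> unit_sphere" and ab: "norm a = 1" "norm b = 1"
  shows "((\<lambda>t. F (circle_point a b t)) has_real_derivative 0) (at t)"
proof -
  let ?c = "circle_point a b"
  have lip: "norm (?c s - ?c t) \<le> 2 * \<bar>s - t\<bar>" for s
  proof -
    have "?c s - ?c t = (cos s - cos t) *\<^sub>R a + (sin s - sin t) *\<^sub>R b"
      by (simp add: circle_point_def algebra_simps)
    then have "norm (?c s - ?c t) \<le> \<bar>cos s - cos t\<bar> + \<bar>sin s - sin t\<bar>"
      using norm_triangle_ineq[of "(cos s - cos t) *\<^sub>R a" "(sin s - sin t) *\<^sub>R b"] ab by simp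
    also have "\<dots> \<le> \<bar>s - t\<bar> + \<bar>s - t\<bar>"
    proof (intro add_mono)
      have le: "\<bar>2 * sin x * w\<bar> \<le> 2 * \<bar>x\<bar>" if "\<bar>w\<bar> \<le> 1" for x w :: real
        using mult_mono[OF abs_sin_x_le_abs_x[of x] that] by (simp add: abs_mult)
      show "\<bar>sin s - sin t\<bar> \<le> \<bar>s - t\<bar>"
        using le[of "cos ((s + t) / 2)" "(s - t) / 2"] by (simp add: sin_diff_sin)
      have "\<bar>cos s - cos t\<bar> = \<bar>2 * sin ((t - s) / 2) * sin ((s + t) / 2)\<bar>"
        by (simp add: cos_diff_cos mult_ac)
      then show "\<bar>cos s - cos t\<bar> \<le> \<bar>s - t\<bar>"
        using le[of "sin ((s + t) / 2)" "(t - s) / 2"] by (simp add: abs_minus_commute)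
    qed
    finally show ?thesis by simp
  qed
  show ?thesis
    unfolding has_field_derivative_def has_derivative_at_alt
  proof (intro conjI allI impI)
    show "bounded_linear ((*) (0::real))" by (rule bounded_linear_mult_right)
    fix e :: real assume e: "0 < e"
    then obtain r where r: "0 < r" and R: "\<And>u v. u \<in> unit_sphere \<inter> ball (?c t) r \<Longrightarrow> v \<in> unit_sphere \<inter> ball (?c t) r \<Longrightarrow>
        \<bar>F u - F v - 0 \<bullet> (u - v)\<bar> \<le> e / 2 * norm (u - v)"
      using grad half_gt_zero[OF e] unfolding has_strict_gradient_def by meson
    have "norm (F (?c s) - F (?c t) - 0 * (s - t)) \<le> e * norm (s - t)" if s: "norm (s - t) < r / 2" for s
    proof -
      have "norm (?c s - ?c t) < r" using lip[of s] s by simp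
      then have "\<bar>F (?c s) - F (?c t) - 0 \<bullet> (?c s - ?c t)\<bar> \<le> e / 2 * norm (?c s - ?c t)"
        using on r by (intro R) (auto simp: dist_norm norm_minus_commute)
      also have "\<dots> \<le> e / 2 * (2 * \<bar>s - t\<bar>)"
        using e lip by (intro mult_left_mono) auto
      finally show ?thesis by simp
    qed
    then show "\<exists>d>0. \<forall>s. norm (s - t) < d \<longrightarrow> norm (F (?c s) - F (?c t) - 0 * (s - t)) \<le> e * norm (s - t)"
      using r by (intro exI[of _ "r / 2"]) simp
  qed
qed

text \<open>At a point of the great circle that is not flat the tangential gradient vanishes, so the
  value there is a critical value of the restriction of \<open>F\<close> to the circle. Working on one circle at
  a time replaces the two-dimensional theorem of Sard, which would need more derivatives.\<close>

lemma negligible_nonflat_values: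
  assumes grad: "\<And>p. p \<in> unit_sphere \<Longrightarrow> \<exists>g. has_strict_gradient F g p unit_sphere"
    and n: "n \<noteq> 0" and \<eta>: "0 < \<eta>"
  shows "negligible {y. \<exists>x\<in>unit_sphere - flat_points F \<eta>. n \<bullet> x = 0 \<and> F x = y}"
proof -
  obtain a where a: "norm a = 1" "n \<bullet> a = 0" by (rule unit_normal_exists)
  obtain b where b: "norm b = 1"
    and on: "\<And>t. circle_point a b t \<in> unit_sphere \<and> n \<bullet> circle_point a b t = 0"
    and onto: "\<And>x. x \<in> unit_sphere \<Longrightarrow> n \<bullet> x = 0 \<Longrightarrow> \<exists>t. 0 \<le> t \<and> t < 2 * pi \<and> x = circle_point a b t"
    by (rule great_circle[OF n a]) blast
  define T where "T = {t. circle_point a b t \<notin> flat_points F \<eta>}"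
  have "negligible ((\<lambda>t. F (circle_point a b t)) ` T)"
  proof (rule negligible_critical_values)
    fix t assume t: "t \<in> T"
    let ?p = "circle_point a b t"
    have p: "?p \<in> unit_sphere" using on by blast
    obtain g where "has_strict_gradient F g ?p unit_sphere" using grad[OF p] by blast
    then have g: "has_strict_gradient F (g - (g \<bullet> ?p) *\<^sub>R ?p) ?p unit_sphere"
      by (rule strict_gradient_tangential)
    have "(g - (g \<bullet> ?p) *\<^sub>R ?p) \<bullet> ?p = 0"
      using p by (simp add: inner_diff_left norm_eq_1)
    then have "g - (g \<bullet> ?p) *\<^sub>R ?p = 0"
      using gradient_imp_flat_point[OF p g _ _ \<eta>] t by (auto simp: T_def)
    with g have "has_strict_gradient F 0 ?p unit_sphere" by simp
    then show "((\<lambda>t. F (circle_point a b t)) has_real_derivative 0) (at t)"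
      using on a b by (intro critical_on_great_circle) auto
  qed
  then show ?thesis
    by (rule negligible_subset) (use onto in \<open>fastforce simp: T_def\<close>)
qed

text \<open>A projection of a closed set along the compact factor \<open>C\<close>.\<close>

lemma closed_hit_set:
  fixes F :: "real^3 \<Rightarrow> real"
  assumes C: "compact C" and F: "continuous_on C F"
  shows "closed {(n, y). \<exists>x\<in>C. n \<bullet> x = 0 \<and> F x = y}"
proof -
  define T :: "((real^3) \<times> (real^3) \<times> real) set" where "T = {w \<in> C \<times> UNIV. fst w \<bullet> fst (snd w) = 0 \<and> F (fst w) = snd (snd w)}"
  have "closed (C \<times> (UNIV :: ((real^3) \<times> real) set))"
    by (rule closed_Times[OF compact_imp_closed[OF C] closed_UNIV])
  then have "closed T"
    unfolding T_def
    by (intro continuous_closed_preimage_constant[of _ "\<lambda>w. (fst w \<bullet> fst (snd w), F (fst w) - snd (snd w))" "(0,0)", simplified]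
        continuous_intros continuous_on_compose2[OF F]) auto
  from closed_compact_projection[OF C this] show ?thesis
    by (rule back_subst[of closed]) (auto simp: T_def inner_commute)
qed

text \<open>Fubini exchanges the order: for every line almost every level is flat along that line, hence
  for almost every level this is so along almost every line.\<close>

lemma AE_level_AE_line_flat:
  assumes grad: "\<And>p. p \<in> unit_sphere \<Longrightarrow> \<exists>g. has_strict_gradient F g p unit_sphere"
    and \<eta>: "0 < \<eta>"
  shows "AE y in lborel. AE n in lborel. \<forall>x\<in>unit_sphere. n \<bullet> x = 0 \<and> F x = y \<longrightarrow> x \<in> flat_points F \<eta>"
proof -
  define C where "C = unit_sphere - flat_points F \<eta>"
  have C: "compact C" unfolding C_def by (intro compact_diff open_flat_points) simp
  have contF: "continuous_on unit_sphere F" by (rule strict_gradient_imp_continuous_on[OF grad])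
  define Z where "Z = {(n, y). \<exists>x\<in>C. n \<bullet> x = 0 \<and> F x = y}"
  have Z: "closed Z"
    unfolding Z_def by (intro closed_hit_set C continuous_on_subset[OF contF]) (auto simp: C_def)
  have meas: "{w \<in> space (lborel \<Otimes>\<^sub>M lborel). (fst w, snd w) \<notin> Z} \<in> sets (lborel \<Otimes>\<^sub>M lborel)"
  proof -
    have "- Z \<in> sets borel" using Z by (intro borel_open) auto
    then show ?thesis by (simp only: lborel_prod sets_lborel space_lborel) (simp add: Compl_eq)
  qed
  have "AE n in lborel. AE y in lborel. (n, y) \<notin> Z"
  proof (rule AE_mp[OF AE_lborel_singleton[of "0 :: real^3"]], rule AE_I2, rule impI)
    fix n :: "real^3" assume n: "n \<noteq> 0"
    have "closed (Pair n -` Z)" by (intro closed_vimage Z continuous_intros)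
    then have b: "Pair n -` Z \<in> sets borel" by (rule borel_closed)
    have "negligible (Pair n -` Z)"
      using negligible_nonflat_values[OF grad n \<eta>] by (rule negligible_subset) (auto simp: Z_def C_def)
    then have "Pair n -` Z \<in> null_sets lborel"
      using b by (simp add: negligible_iff_null_sets null_sets_completion_iff)
    then show "AE y in lborel. (n, y) \<notin> Z"
      by (rule AE_I') auto
  qed
  then have "AE y in lborel. AE n in lborel. (n, y) \<notin> Z"
    using lborel_pair.AE_commute[OF meas] by simp
  then show ?thesis
  proof (rule eventually_mono)
    fix y assume "AE n in lborel. (n, y) \<notin> Z"
    then show "AE n in lborel. \<forall>x\<in>unit_sphere. n \<bullet> x = 0 \<and> F x = y \<longrightarrow> x \<in> flat_points F \<eta>"
      by (rule eventually_mono) (auto simp: Z_def C_def)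
  qed
qed

section \<open>A common value of all lines, and the fibres near it\<close>

text \<open>Lines of the projective plane are closed loops, so a function that takes values on both sides
  of \<open>y\<close> attains \<open>y\<close> on each of the two arcs between. Half of the great circle, from \<open>u\<close> to \<open>- u\<close>,
  is one full turn around the line.\<close>

lemma level_hits_circle_twice:
  fixes F :: "real^3 \<Rightarrow> real"
  assumes F: "continuous_on unit_sphere F" and even: "\<And>x. x \<in> unit_sphere \<Longrightarrow> F (- x) = F x"
    and n: "n \<noteq> 0" and u: "u \<in> unit_sphere" "n \<bullet> u = 0" "F u < y" and v: "v \<in> unit_sphere" "n \<bullet> v = 0" "y < F v"
  shows "\<exists>p\<in>unit_sphere. \<exists>q\<in>unit_sphere. n \<bullet> p = 0 \<and> n \<bullet> q = 0 \<and> F p = y \<and> F q = y \<and> p \<noteq> q \<and> p \<noteq> - q"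
proof -
  have "norm u = 1" using u by simp
  then obtain b where b: "norm b = 1" "u \<bullet> b = 0"
    and on: "\<And>t. circle_point u b t \<in> unit_sphere \<and> n \<bullet> circle_point u b t = 0"
    and onto: "\<And>x. x \<in> unit_sphere \<Longrightarrow> n \<bullet> x = 0 \<Longrightarrow> \<exists>t. 0 \<le> t \<and> t < 2 * pi \<and> x = circle_point u b t"
    by (rule great_circle[OF n _ u(2)]) blast
  let ?c = "circle_point u b"
  define h where "h t = F (?c t)" for t
  have conth: "continuous_on A h" for A
    unfolding h_def by (rule continuous_on_compose2[OF F continuous_circle_point]) (use on in blast)
  have h0: "h 0 < y" "h pi < y"
    using u even by (auto simp: h_def circle_point_def)
  obtain t where t: "0 \<le> t" "t < 2 * pi" "v = ?c t" using onto v by blast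
  have "\<exists>s. 0 \<le> s \<and> s \<le> pi \<and> y < h s"
  proof (cases "t \<le> pi")
    case True
    then show ?thesis using t v by (auto simp: h_def)
  next
    case False
    \<comment> \<open>By evenness the value at \<open>v\<close> is also attained at \<open>- v\<close>, on the first half of the circle.\<close>
    have "?c (t - pi) = - v" by (simp add: t(3) circle_point_def)
    then show ?thesis using False t v even by (intro exI[of _ "t - pi"]) (auto simp: h_def)
  qed
  then obtain s where s: "0 \<le> s" "s \<le> pi" "y < h s" by blast
  obtain \<alpha> where \<alpha>: "0 \<le> \<alpha>" "\<alpha> \<le> s" "h \<alpha> = y"
    using IVT'[of h 0 y s] h0 s conth by force
  obtain \<beta> where \<beta>: "s \<le> \<beta>" "\<beta> \<le> pi" "h \<beta> = y"
    using IVT2'[of h pi y s] h0 s conth by force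
  have strict: "0 < \<alpha>" "\<alpha> < s" "s < \<beta>" "\<beta> < pi"
    using \<alpha> \<beta> s h0 by (auto simp: less_le)
  have coord: "u \<bullet> ?c t = cos t" "b \<bullet> ?c t = sin t" for t
    using u b by (simp_all add: circle_point_def inner_add_right norm_eq_1 inner_commute[of b u])
  have "cos \<beta> < cos \<alpha>" using strict by (intro cos_monotone_0_pi) auto
  then have "?c \<alpha> \<noteq> ?c \<beta>" by (metis coord(1) less_irrefl)
  moreover have "0 < sin \<alpha>" "0 < sin \<beta>" using strict by (auto intro!: sin_gt_zero)
  then have "?c \<alpha> \<noteq> - ?c \<beta>" by (metis coord(2) inner_minus_right less_asym neg_0_less_iff_less)
  ultimately show ?thesis
    using on \<alpha> \<beta> unfolding h_def by blast
qed

lemma great_circles_meet: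
  fixes n m :: "real^3"
  assumes "n \<noteq> 0"
  obtains w where "w \<in> unit_sphere" "n \<bullet> w = 0" "m \<bullet> w = 0"
proof (cases "cross3 n m = 0")
  case False
  show thesis
  proof
    show "cross3 n m /\<^sub>R norm (cross3 n m) \<in> unit_sphere" using False by simp
  qed (simp_all add: dot_cross_self)
next
  case True
  obtain w :: "real^3" where w: "norm w = 1" "n \<bullet> w = 0" by (rule unit_normal_exists)
  have "collinear {0, n, m}" using True cross_eq_0 by blast
  then have "m = 0 \<or> (\<exists>c. m = c *\<^sub>R n)" using assms by (auto simp: collinear_lemma)
  then have "m \<bullet> w = 0" using w by auto
  with w that show thesis by auto
qed

lemma closed_normals_meeting:
  fixes C :: "(real^3) set"
  assumes "compact C"
  shows "closed {n. \<exists>x\<in>C. n \<bullet> x = 0}"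
proof -
  have "closed ((\<lambda>n::real^3. (n, 0::real)) -` {(n, y). \<exists>x\<in>C. n \<bullet> x = 0 \<and> 0 = y})"
    by (intro closed_vimage closed_hit_set assms continuous_intros)
  then show ?thesis by (simp add: vimage_def)
qed

text \<open>The set is a countable union of closed sets, one for each level slightly above \<open>t\<close>.\<close>

lemma borel_normals_meeting_superlevel:
  fixes F :: "real^3 \<Rightarrow> real"
  assumes F: "continuous_on unit_sphere F"
  shows "{n. \<exists>x\<in>unit_sphere. n \<bullet> x = 0 \<and> t < F x} \<in> sets borel"
proof -
  have comp: "compact {x \<in> unit_sphere. t + inverse (real (Suc k)) \<le> F x}" for k
  proof -
    let ?S = "{x \<in> unit_sphere. t + inverse (real (Suc k)) \<le> F x}"
    have "closed ?S"
      by (intro continuous_on_closed_Collect_le continuous_intros F) auto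
    then have "compact (unit_sphere \<inter> ?S)" by (intro compact_Int_closed) auto
    moreover have "unit_sphere \<inter> ?S = ?S" by auto
    ultimately show ?thesis by simp
  qed
  have "{n. \<exists>x\<in>unit_sphere. n \<bullet> x = 0 \<and> t < F x} =
      (\<Union>k. {n. \<exists>x\<in>{x \<in> unit_sphere. t + inverse (real (Suc k)) \<le> F x}. n \<bullet> x = 0})"
  proof (intro equalityI subsetI)
    fix n assume "n \<in> {n. \<exists>x\<in>unit_sphere. n \<bullet> x = 0 \<and> t < F x}"
    then obtain x where x: "x \<in> unit_sphere" "n \<bullet> x = 0" "t < F x" by blast
    obtain k where "inverse (real (Suc k)) < F x - t"
      using reals_Archimedean[of "F x - t"] x by auto
    with x show "n \<in> (\<Union>k. {n. \<exists>x\<in>{x \<in> unit_sphere. t + inverse (real (Suc k)) \<le> F x}. n \<bullet> x = 0})"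
      by (intro UN_I[of k]) auto
  next
    fix n assume "n \<in> (\<Union>k. {n. \<exists>x\<in>{x \<in> unit_sphere. t + inverse (real (Suc k)) \<le> F x}. n \<bullet> x = 0})"
    then obtain k x where x: "x \<in> unit_sphere" "t + inverse (real (Suc k)) \<le> F x" "n \<bullet> x = 0" by blast
    have "0 < inverse (real (Suc k))" by simp
    then have "t < F x" using x(2) by linarith
    with x show "n \<in> {n. \<exists>x\<in>unit_sphere. n \<bullet> x = 0 \<and> t < F x}" by blast
  qed
  also have "\<dots> \<in> sets borel"
    by (intro sets.countable_UN'' borel_closed closed_normals_meeting comp) auto
  finally show ?thesis .
qed

text \<open>In the limit \<open>\<eta> = 0\<close> the claim reads \<open>(2 * pi - \<epsilon>) * 4 / 3 < 2 * (4 / 3 * pi)\<close>.\<close>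

lemma crofton_constant_limit:
  assumes "0 < (\<epsilon>::real)"
  obtains \<eta> where "0 < \<eta>" "\<eta> < 1"
    "(2 * pi - \<epsilon>) * ((4 / 3 + 16 * \<eta>) / (1 - \<eta> / 2)) < 2 * (4 / 3 * pi - \<eta>)"
proof -
  \<comment> \<open>The difference of the two sides, which is continuous at 0 and positive there.\<close>
  define k where "k x = 2 * (4 / 3 * pi - x) - (2 * pi - \<epsilon>) * ((4 / 3 + 16 * x) / (1 - x / 2))" for x :: real
  have "isCont k 0" unfolding k_def by (intro continuous_intros) auto
  then have "(k \<longlongrightarrow> k 0) (at_right 0)"
    unfolding continuous_at by (rule tendsto_mono[rotated]) (simp add: at_le)
  moreover have "0 < k 0" using assms by (simp add: k_def algebra_simps)
  ultimately have "\<forall>\<^sub>F x in at_right 0. 0 < k x" by (rule order_tendstoD(1))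
  moreover have "\<forall>\<^sub>F x in at_right (0::real). x \<in> {0<..<1}"
    by (rule eventually_at_right_real) simp
  ultimately have "\<forall>\<^sub>F x in at_right 0. 0 < x \<and> x < 1 \<and> 0 < k x"
    by eventually_elim auto
  then obtain \<eta> where "0 < \<eta>" "\<eta> < 1" "0 < k \<eta>"
    using eventually_happens'[OF trivial_limit_at_right_real] by blast
  then show thesis using that by (simp add: k_def)
qed

text \<open>Almost every line meets the set where \<open>F > a\<close>; by continuity of the measure, all but a
  small proportion of the lines still meet the set where \<open>F > y\<close>, for every \<open>y\<close> slightly above \<open>a\<close>.
  These lines also meet the set where \<open>F \<le> a\<close>, so they hit the level \<open>y\<close> at least twice. Among these levels
  almost every one is flat along almost every line, so the sharp Crofton bound applies with two
  intersections.\<close>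

lemma long_fiber_near_minmax:
  fixes f :: "rp2 \<Rightarrow> real"
  defines "F \<equiv> \<lambda>x. f (proj_rp2 x)"
  assumes grad: "\<And>p. p \<in> unit_sphere \<Longrightarrow> \<exists>g. has_strict_gradient F g p unit_sphere"
    and low: "\<And>n. n \<noteq> 0 \<Longrightarrow> \<exists>x\<in>unit_sphere. n \<bullet> x = 0 \<and> F x \<le> a"
    and null: "{n \<in> ball 0 1. \<forall>x\<in>unit_sphere. n \<bullet> x = 0 \<longrightarrow> F x \<le> a} \<in> null_sets lborel"
    and \<epsilon>: "0 < \<epsilon>"
  shows "\<exists>y. ennreal (2 * pi - \<epsilon>) \<le> hausdorff1 (f -` {y})"
proof -
  have contF: "continuous_on unit_sphere F" by (rule strict_gradient_imp_continuous_on[OF grad])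
  have even: "F (- x) = F x" if "x \<in> unit_sphere" for x
    using proj_rp2_minus[OF that] by (simp add: F_def)
  obtain \<eta> where \<eta>: "0 < \<eta>" "\<eta> < 1"
    and const: "(2 * pi - \<epsilon>) * ((4 / 3 + 16 * \<eta>) / (1 - \<eta> / 2)) < 2 * (4 / 3 * pi - \<eta>)"
    by (rule crofton_constant_limit[OF \<epsilon>])
  define Up where "Up t = {n \<in> ball 0 1. \<exists>x\<in>unit_sphere. n \<bullet> x = 0 \<and> t < F x}" for t
  have Up: "Up t \<in> sets borel" for t
  proof -
    have "Up t = ball 0 1 \<inter> {n. \<exists>x\<in>unit_sphere. n \<bullet> x = 0 \<and> t < F x}" by (auto simp: Up_def)
    then show ?thesis using borel_normals_meeting_superlevel[OF contF, of t] by simp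
  qed
  have vol: "emeasure lborel (ball 0 1 :: (real^3) set) = ennreal (4 / 3 * pi)"
    by (simp add: emeasure_ball eval_unit_ball_vol)
  have "Up a = ball 0 1 - {n \<in> ball 0 1. \<forall>x\<in>unit_sphere. n \<bullet> x = 0 \<longrightarrow> F x \<le> a}"
    by (auto simp: Up_def not_le)
  then have volUp: "emeasure lborel (Up a) = ennreal (4 / 3 * pi)"
    using null vol by (simp add: emeasure_Diff_null_set)
  define t where "t k = a + inverse (real (Suc k))" for k
  have "(\<lambda>k. emeasure lborel (Up (t k))) \<longlonglongrightarrow> emeasure lborel (\<Union>k. Up (t k))"
  proof (rule Lim_emeasure_incseq)
    show "range (\<lambda>k. Up (t k)) \<subseteq> sets lborel" using Up by auto
    show "incseq (\<lambda>k. Up (t k))"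
    proof (rule incseq_SucI)
      fix k
      have "t (Suc k) \<le> t k" unfolding t_def by (intro add_left_mono le_imp_inverse_le) auto
      then show "Up (t k) \<subseteq> Up (t (Suc k))"
        unfolding Up_def by (auto intro: le_less_trans)
    qed
  qed
  also have "(\<Union>k. Up (t k)) = Up a"
  proof (intro equalityI subsetI)
    fix n assume "n \<in> (\<Union>k. Up (t k))"
    then obtain k x where x: "n \<in> ball 0 1" "x \<in> unit_sphere" "n \<bullet> x = 0" "t k < F x" by (auto simp: Up_def)
    have "a < t k" by (simp add: t_def)
    with x show "n \<in> Up a" by (auto simp: Up_def intro!: bexI[of _ x])
  next
    fix n assume "n \<in> Up a"
    then obtain x where x: "n \<in> ball 0 1" "x \<in> unit_sphere" "n \<bullet> x = 0" "a < F x" by (auto simp: Up_def)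
    obtain k where "inverse (real (Suc k)) < F x - a"
      using reals_Archimedean[of "F x - a"] x by auto
    with x show "n \<in> (\<Union>k. Up (t k))"
      by (intro UN_I[of k]) (auto simp: Up_def t_def intro!: bexI[of _ x])
  qed
  finally have "(\<lambda>k. emeasure lborel (Up (t k))) \<longlonglongrightarrow> ennreal (4 / 3 * pi)" by (simp add: volUp)
  moreover have "ennreal (4 / 3 * pi - \<eta>) < ennreal (4 / 3 * pi)"
    using \<eta> pi_gt_zero by (intro ennreal_lessI) auto
  ultimately have "\<forall>\<^sub>F k in sequentially. ennreal (4 / 3 * pi - \<eta>) < emeasure lborel (Up (t k))"
    by (rule order_tendstoD(1))
  then obtain k where k: "ennreal (4 / 3 * pi - \<eta>) < emeasure lborel (Up (t k))"
    using eventually_happens'[OF sequentially_bot] by blast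
  define flat where "flat y n \<longleftrightarrow> (\<forall>x\<in>unit_sphere. n \<bullet> x = 0 \<and> F x = y \<longrightarrow> x \<in> flat_points F \<eta>)" for y n
  have "AE y in lborel. AE n in lborel. flat y n"
    unfolding flat_def by (rule AE_level_AE_line_flat[OF grad \<eta>(1)])
  then obtain M where M: "M \<in> null_sets lborel" "{y. \<not> (AE n in lborel. flat y n)} \<subseteq> M"
    by (auto simp: eventually_ae_filter)
  have "\<not> {a<..<t k} \<subseteq> M"
  proof
    assume "{a<..<t k} \<subseteq> M"
    then have "{a<..<t k} \<in> null_sets lborel" by (intro null_sets_subset[OF M(1)]) auto
    moreover have "emeasure lborel {a<..<t k} = ennreal (inverse (real (Suc k)))"
      by (simp add: t_def)
    ultimately show False by (simp add: null_sets_def)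
  qed
  then obtain y where y: "a < y" "y < t k" and AEy: "AE n in lborel. flat y n"
  proof -
    obtain y where "y \<in> {a<..<t k}" "y \<notin> M" using \<open>\<not> {a<..<t k} \<subseteq> M\<close> by blast
    then show thesis using that[of y] M(2) by auto
  qed
  then obtain Z where Z: "Z \<in> null_sets lborel" "{n. \<not> flat y n} \<subseteq> Z"
    by (auto simp: eventually_ae_filter)
  define G where "G = Up y - Z - {0}"
  have null0: "Z \<union> {0} \<in> null_sets lborel"
    using Z by (intro null_sets.Un) auto
  have G_eq: "G = Up y - (Z \<union> {0})" by (auto simp: G_def)
  have G: "G \<in> sets borel"
    using Up[of y] Z(1) by (auto simp: G_def)
  have "Up (t k) \<subseteq> Up y" using y by (auto simp: Up_def)
  then have "emeasure lborel (Up (t k)) \<le> emeasure lborel (Up y)"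
    using Up by (intro emeasure_mono) auto
  also have "\<dots> = emeasure lborel G"
    unfolding G_eq using Up null0 by (intro emeasure_Diff_null_set[symmetric]) auto
  finally have volG: "ennreal (4 / 3 * pi - \<eta>) \<le> emeasure lborel G"
    using k by auto
  have "of_nat 2 * emeasure lborel G \<le> ennreal ((4 / 3 + 16 * \<eta>) / (1 - \<eta> / 2)) * hausdorff1 (f -` {y})"
  proof (rule crofton_lower_bound[OF \<eta>(1) less_imp_le[OF \<eta>(2)] G])
    show "G \<subseteq> ball 0 1" by (auto simp: G_def Up_def)
    fix n assume n: "n \<in> G"
    then have n0: "n \<noteq> 0" and fl: "flat y n" using Z(2) by (auto simp: G_def)
    obtain v where v: "v \<in> unit_sphere" "n \<bullet> v = 0" "y < F v"
      using n by (auto simp: G_def Up_def)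
    obtain u where u: "u \<in> unit_sphere" "n \<bullet> u = 0" "F u < y"
      using low[OF n0] y by force
    obtain p q where pq: "p \<in> unit_sphere" "q \<in> unit_sphere" "n \<bullet> p = 0" "n \<bullet> q = 0" "F p = y" "F q = y" "p \<noteq> q" "p \<noteq> - q"
      using level_hits_circle_twice[OF contF even n0 u v] by blast
    have "proj_rp2 p \<noteq> proj_rp2 q" using pq proj_rp2_eq_iff[of p q] by auto
    then have card: "card {proj_rp2 p, proj_rp2 q} = 2" by simp
    have "p \<in> flat_points F \<eta>" "q \<in> flat_points F \<eta>" using fl pq by (auto simp: flat_def)
    with pq have "\<forall>s\<in>{proj_rp2 p, proj_rp2 q}. \<exists>x\<in>unit_sphere. proj_rp2 x = s \<and> n \<bullet> x = 0 \<and> f s = y \<and> x \<in> flat_points F \<eta>"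
      by (auto simp: F_def)
    with card show "\<exists>P. finite P \<and> card P = 2 \<and> (\<forall>p\<in>P. \<exists>x\<in>unit_sphere. proj_rp2 x = p \<and> n \<bullet> x = 0 \<and>
        f p = y \<and> x \<in> flat_points (\<lambda>x. f (proj_rp2 x)) \<eta>)"
      unfolding F_def by (intro exI[of _ "{proj_rp2 p, proj_rp2 q}"]) simp
  qed
  moreover have "of_nat 2 * ennreal (4 / 3 * pi - \<eta>) \<le> of_nat 2 * emeasure lborel G"
    using volG by (intro mult_left_mono) auto
  ultimately have main: "of_nat 2 * ennreal (4 / 3 * pi - \<eta>) \<le> ennreal ((4 / 3 + 16 * \<eta>) / (1 - \<eta> / 2)) * hausdorff1 (f -` {y})"
    by (rule order_trans[rotated])
  define c where "c = (4 / 3 + 16 * \<eta>) / (1 - \<eta> / 2)"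
  have c: "0 < c" using \<eta> by (simp add: c_def)
  have "ennreal (2 * pi - \<epsilon>) \<le> hausdorff1 (f -` {y})"
  proof (cases "hausdorff1 (f -` {y})")
    case (real r)
    have pos: "0 \<le> 4 / 3 * pi - \<eta>" using \<eta> pi_gt3 by simp
    have "ennreal (2 * (4 / 3 * pi - \<eta>)) = of_nat 2 * ennreal (4 / 3 * pi - \<eta>)"
      using pos by (subst ennreal_mult) auto
    also have "\<dots> \<le> ennreal (c * r)"
      using main real c by (simp add: c_def[symmetric] ennreal_mult)
    finally have "2 * (4 / 3 * pi - \<eta>) \<le> c * r"
      using real c by (subst (asm) ennreal_le_iff) auto
    then have "(2 * pi - \<epsilon>) * c < c * r" using const by (simp add: c_def)
    then have "2 * pi - \<epsilon> < r" using c by (simp add: mult.commute)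
    then show ?thesis using real by (simp add: ennreal_leI)
  next
    case top
    then show ?thesis by simp
  qed
  then show ?thesis ..
qed

text \<open>If the points common to a line \<open>n\<close> of \<open>A\<close> and the lines of \<open>B\<close> were finite in number, then
  \<open>B\<close> would be covered by finitely many pencils of lines, which are null sets. At each such point
  \<open>F\<close> equals \<open>a\<close>. So every line of \<open>A\<close> meets the fibre in arbitrarily many points, and the
  crude Crofton bound, with \<open>\<eta> = 1\<close>, gives infinite length.\<close>

lemma infinite_fiber_length:
  fixes f :: "rp2 \<Rightarrow> real"
  defines "F \<equiv> \<lambda>x. f (proj_rp2 x)"
  assumes A: "A \<in> sets borel" "A \<subseteq> ball 0 1" "A \<notin> null_sets lborel"
    and A_le: "\<And>n x. n \<in> A \<Longrightarrow> x \<in> unit_sphere \<Longrightarrow> n \<bullet> x = 0 \<Longrightarrow> F x \<le> a"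
    and B: "B \<in> sets borel" "B \<notin> null_sets lborel"
    and B_ge: "\<And>n x. n \<in> B \<Longrightarrow> x \<in> unit_sphere \<Longrightarrow> n \<bullet> x = 0 \<Longrightarrow> a \<le> F x"
  shows "hausdorff1 (f -` {a}) = \<infinity>"
proof (rule ccontr)
  assume fin: "hausdorff1 (f -` {a}) \<noteq> \<infinity>"
  define I where "I n = {x \<in> unit_sphere. n \<bullet> x = 0 \<and> F x = a}" for n
  have inf: "infinite (proj_rp2 ` I n)" if n: "n \<in> A - {0}" for n
  proof
    assume "finite (proj_rp2 ` I n)"
    have "\<forall>p. \<exists>x. x \<in> unit_sphere \<and> proj_rp2 x = p"
    proof
      show "\<exists>x. x \<in> unit_sphere \<and> proj_rp2 x = p" for p
        by (rule rp2_cases[of p]) blast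
    qed
    from choice[OF this] obtain g where g: "\<And>p. g p \<in> unit_sphere \<and> proj_rp2 (g p) = p" by blast
    have "I n \<subseteq> (\<Union>p\<in>proj_rp2 ` I n. {g p, - g p})"
    proof
      fix x assume x: "x \<in> I n"
      then have "x \<in> unit_sphere" by (simp add: I_def)
      then have "x = g (proj_rp2 x) \<or> x = - g (proj_rp2 x)"
        using g[of "proj_rp2 x"] proj_rp2_eq_iff[of "g (proj_rp2 x)" x] by auto
      with x show "x \<in> (\<Union>p\<in>proj_rp2 ` I n. {g p, - g p})" by blast
    qed
    then have finI: "finite (I n)"
      by (rule finite_subset) (rule finite_UN_I[OF \<open>finite (proj_rp2 ` I n)\<close>], simp)
    have "B \<subseteq> (\<Union>x\<in>I n. {m. x \<bullet> m = 0})"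
    proof
      fix m assume m: "m \<in> B"
      obtain w where w: "w \<in> unit_sphere" "n \<bullet> w = 0" "m \<bullet> w = 0"
        using great_circles_meet[of n m] n by auto
      have "F w = a"
        using A_le[of n w] B_ge[OF m w(1,3)] n w by auto
      then show "m \<in> (\<Union>x\<in>I n. {m. x \<bullet> m = 0})"
        using w by (auto simp: I_def inner_commute intro!: bexI[of _ w])
    qed
    moreover have "negligible (\<Union>x\<in>I n. {m. x \<bullet> m = 0})"
    proof (rule negligible_Union)
      show "finite ((\<lambda>x. {m. x \<bullet> m = 0}) ` I n)" using finI by simp
      show "negligible H" if "H \<in> (\<lambda>x. {m. x \<bullet> m = 0}) ` I n" for H
        using that by (auto simp: I_def intro!: negligible_hyperplane)
    qed
    ultimately have "negligible B" by (rule negligible_subset[rotated])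
    then show False
      using B by (simp add: negligible_iff_null_sets null_sets_completion_iff)
  qed
  have bound: "of_nat N * emeasure lborel (A - {0}) \<le> ennreal ((4 / 3 + 16 * 1) / (1 - 1 / 2)) * hausdorff1 (f -` {a})" for N
  proof (rule crofton_lower_bound)
    show "A - {0} \<in> sets borel" "A - {0} \<subseteq> ball 0 1" using A by auto
    fix n assume "n \<in> A - {0}"
    then obtain P where P: "P \<subseteq> proj_rp2 ` I n" "finite P" "card P = N"
      using infinite_arbitrarily_large[OF inf] by blast
    have "\<exists>x\<in>unit_sphere. proj_rp2 x = p \<and> n \<bullet> x = 0 \<and> f p = a \<and> x \<in> flat_points (\<lambda>x. f (proj_rp2 x)) 1" if "p \<in> P" for p
    proof -
      obtain x where "x \<in> I n" "proj_rp2 x = p" using \<open>p \<in> P\<close> P(1) by blast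
      then have x: "x \<in> unit_sphere" "proj_rp2 x = p \<and> n \<bullet> x = 0 \<and> f p = a"
        by (auto simp: I_def F_def)
      show ?thesis
        using x subsetD[OF sphere_subset_flat_points_1 x(1)] by blast
    qed
    with P show "\<exists>P. finite P \<and> card P = N \<and> (\<forall>p\<in>P. \<exists>x\<in>unit_sphere. proj_rp2 x = p \<and> n \<bullet> x = 0 \<and>
        f p = a \<and> x \<in> flat_points (\<lambda>x. f (proj_rp2 x)) 1)"
      by blast
  qed auto
  obtain s where s: "hausdorff1 (f -` {a}) = ennreal s" "0 \<le> s"
    using fin by (cases "hausdorff1 (f -` {a})") auto
  define c :: real where "c = (4 / 3 + 16 * 1) / (1 - 1 / 2)"
  have c: "0 \<le> c" by (simp add: c_def)
  have bound': "of_nat N * emeasure lborel (A - {0}) \<le> ennreal (c * s)" for N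
    using bound[of N] unfolding c_def[symmetric] s(1) using c s(2) by (simp add: ennreal_mult)
  have eA: "emeasure lborel (A - {0}) = emeasure lborel A"
    using A by (intro emeasure_Diff_null_set) auto
  have "emeasure lborel A \<le> emeasure lborel (ball 0 1 :: (real^3) set)"
    using A by (intro emeasure_mono) auto
  also have "\<dots> < \<infinity>" by (rule emeasure_lborel_ball_finite)
  finally obtain \<alpha> where \<alpha>: "emeasure lborel A = ennreal \<alpha>" "0 \<le> \<alpha>"
    by (cases "emeasure lborel A") auto
  have "\<alpha> \<noteq> 0" using A \<alpha> by (auto simp: null_sets_def)
  then have "0 < \<alpha>" using \<alpha> by simp
  then obtain N where N: "c * s < real N * \<alpha>" using reals_Archimedean3 by blast
  have "ennreal (real N * \<alpha>) = of_nat N * emeasure lborel (A - {0})"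
    using \<alpha> by (simp add: eA ennreal_mult ennreal_of_nat_eq_real_of_nat)
  also have "\<dots> \<le> ennreal (c * s)" by (rule bound')
  finally have "real N * \<alpha> \<le> c * s"
    using c s(2) by (simp add: ennreal_le_iff)
  then show False using N by simp
qed

text \<open>Any two lines of the projective plane meet, so the minimum of \<open>F\<close> on one line never exceeds
  the maximum of \<open>F\<close> on another. The largest of the minima is therefore a common value.\<close>

lemma minmax_over_great_circles:
  fixes F :: "real^3 \<Rightarrow> real"
  assumes F: "continuous_on unit_sphere F"
  obtains a where "\<And>n. n \<noteq> 0 \<Longrightarrow> \<exists>x\<in>unit_sphere. n \<bullet> x = 0 \<and> F x \<le> a"
    "\<And>n. n \<noteq> 0 \<Longrightarrow> \<exists>x\<in>unit_sphere. n \<bullet> x = 0 \<and> a \<le> F x"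
proof -
  define L where "L n = {x \<in> unit_sphere. n \<bullet> x = 0}" for n
  have L: "compact (L n)" "L n \<noteq> {}" for n
  proof -
    have "closed {x. n \<bullet> x = 0}" by (intro closed_Collect_eq continuous_intros)
    then have "compact (unit_sphere \<inter> {x. n \<bullet> x = 0})" by (intro compact_Int_closed) auto
    moreover have "unit_sphere \<inter> {x. n \<bullet> x = 0} = L n" unfolding L_def by blast
    ultimately show "compact (L n)" by simp
    obtain w :: "real^3" where "norm w = 1" "n \<bullet> w = 0" by (rule unit_normal_exists)
    then have "w \<in> L n" by (simp add: L_def)
    then show "L n \<noteq> {}" by blast
  qed
  have contL: "continuous_on (L n) F" for n
    by (rule continuous_on_subset[OF F]) (auto simp: L_def)
  \<comment> \<open>The lower bounds for \<open>F\<close> on some line; their supremum is the maximum of the minima.\<close>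
  define T where "T = {t. \<exists>n. n \<noteq> 0 \<and> (\<forall>x\<in>L n. t \<le> F x)}"
  obtain x\<^sub>m where x\<^sub>m: "\<And>x. x \<in> unit_sphere \<Longrightarrow> F x \<le> F x\<^sub>m"
  proof -
    have "(unit_sphere :: (real^3) set) \<noteq> {}" by simp
    from continuous_attains_sup[OF compact_sphere this F] show thesis using that by blast
  qed
  have "t \<le> F x\<^sub>m" if t: "t \<in> T" for t
  proof -
    obtain n where n: "\<forall>x\<in>L n. t \<le> F x" using t by (auto simp: T_def)
    obtain x where x: "x \<in> L n" using L(2) by blast
    then have "x \<in> unit_sphere" by (simp add: L_def)
    from x\<^sub>m[OF this] n x show ?thesis by force
  qed
  then have bdd: "bdd_above T" by (rule bdd_aboveI)
  show thesis
  proof (rule that[of "Sup T"])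
    fix n :: "real^3" assume n: "n \<noteq> 0"
    obtain x where x: "x \<in> L n" "\<forall>z\<in>L n. F x \<le> F z"
      using continuous_attains_inf[OF L contL] by blast
    then have "F x \<in> T" using n unfolding T_def by blast
    then have "F x \<le> Sup T" using bdd by (rule cSup_upper)
    with x show "\<exists>x\<in>unit_sphere. n \<bullet> x = 0 \<and> F x \<le> Sup T" by (auto simp: L_def)
    from \<open>F x \<in> T\<close> have "T \<noteq> {}" by blast
    obtain z where z: "z \<in> L n" "\<forall>x\<in>L n. F x \<le> F z"
      using continuous_attains_sup[OF L contL] by blast
    have "Sup T \<le> F z"
    proof (rule cSup_least[OF \<open>T \<noteq> {}\<close>])
      fix t assume "t \<in> T"
      then obtain m where m: "\<forall>x\<in>L m. t \<le> F x" by (auto simp: T_def)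
      obtain w where "w \<in> unit_sphere" "n \<bullet> w = 0" "m \<bullet> w = 0" using great_circles_meet[OF n] by blast
      then have "w \<in> L n" "w \<in> L m" by (auto simp: L_def)
      with m z show "t \<le> F z" by force
    qed
    with z show "\<exists>x\<in>unit_sphere. n \<bullet> x = 0 \<and> Sup T \<le> F x" by (auto simp: L_def)
  qed
qed

lemma has_strict_gradient_minus:
  assumes "has_strict_gradient F g p S"
  shows "has_strict_gradient (\<lambda>x. - F x) (- g) p S"
proof -
  have "- F u - - F v - (- g) \<bullet> (u - v) = - (F u - F v - g \<bullet> (u - v))" for u v
    by (simp add: inner_minus_left)
  then show ?thesis
    using assms unfolding has_strict_gradient_def by (simp only: abs_minus_cancel)
qed

theorem theorem2p10:
  fixes f :: "rp2 \<Rightarrow> real" and \<epsilon> :: real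
  assumes "real_analytic_rp2 f" and "0 < \<epsilon>"
  shows "\<exists>y. ennreal (2 * pi - \<epsilon>) \<le> hausdorff1 (f -` {y})"
proof -
  define F where "F = (\<lambda>x. f (proj_rp2 x))"
  have grad: "\<exists>g. has_strict_gradient F g p unit_sphere" if "p \<in> unit_sphere" for p
    unfolding F_def by (rule lift_strict_gradient[OF assms(1) that])
  have contF: "continuous_on unit_sphere F" by (rule strict_gradient_imp_continuous_on[OF grad])
  obtain a where low: "\<And>n. n \<noteq> 0 \<Longrightarrow> \<exists>x\<in>unit_sphere. n \<bullet> x = 0 \<and> F x \<le> a"
    and high: "\<And>n. n \<noteq> 0 \<Longrightarrow> \<exists>x\<in>unit_sphere. n \<bullet> x = 0 \<and> a \<le> F x"
    by (rule minmax_over_great_circles[OF contF]) blast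
  define A where "A = {n \<in> ball 0 1. \<forall>x\<in>unit_sphere. n \<bullet> x = 0 \<longrightarrow> F x \<le> a}"
  define B where "B = {n \<in> ball 0 1. \<forall>x\<in>unit_sphere. n \<bullet> x = 0 \<longrightarrow> - F x \<le> - a}"
  consider "A \<in> null_sets lborel" | "B \<in> null_sets lborel" | "A \<notin> null_sets lborel" "B \<notin> null_sets lborel"
    by blast
  then show ?thesis
  proof cases
    case 1
    then show ?thesis
      using long_fiber_near_minmax[of f a] grad low assms(2) unfolding A_def F_def by blast
  next
    case 2
    have "\<exists>y. ennreal (2 * pi - \<epsilon>) \<le> hausdorff1 ((\<lambda>p. - f p) -` {y})"
    proof (rule long_fiber_near_minmax[of "\<lambda>p. - f p" "- a"])
      show "\<exists>g. has_strict_gradient (\<lambda>x. - f (proj_rp2 x)) g p unit_sphere" if "p \<in> unit_sphere" for p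
        using grad[OF that] has_strict_gradient_minus unfolding F_def by blast
      show "\<exists>x\<in>unit_sphere. n \<bullet> x = 0 \<and> - f (proj_rp2 x) \<le> - a" if "n \<noteq> 0" for n
        using high[OF that] by (simp add: F_def)
    qed (use 2 assms(2) in \<open>auto simp: B_def F_def\<close>)
    then obtain y where "ennreal (2 * pi - \<epsilon>) \<le> hausdorff1 ((\<lambda>p. - f p) -` {y})" by blast
    moreover have "(\<lambda>p. - f p) -` {y} = f -` {- y}" by auto
    ultimately show ?thesis by auto
  next
    case 3
    have borel: "{n \<in> ball 0 1. \<forall>x\<in>unit_sphere. n \<bullet> x = 0 \<longrightarrow> K x \<le> t} \<in> sets borel"
      if "continuous_on unit_sphere K" for K :: "real^3 \<Rightarrow> real" and t
    proof -
      have "{n \<in> ball 0 1. \<forall>x\<in>unit_sphere. n \<bullet> x = 0 \<longrightarrow> K x \<le> t}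
        = ball 0 1 - {n. \<exists>x\<in>unit_sphere. n \<bullet> x = 0 \<and> t < K x}" by (auto simp: not_le)
      then show ?thesis using borel_normals_meeting_superlevel[OF that, of t] by simp
    qed
    have "hausdorff1 (f -` {a}) = \<infinity>"
    proof (rule infinite_fiber_length[of A _ _ B])
      show "A \<in> sets borel" unfolding A_def by (rule borel[OF contF])
      show "B \<in> sets borel" unfolding B_def by (intro borel continuous_intros contF)
    qed (use 3 in \<open>auto simp: A_def B_def F_def\<close>)
    then show ?thesis by (intro exI[of _ a]) simp
  qed
qed

end
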